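(* Let $G$ be a torsion group whose center $\mathcal{Z}(G)$ has finite index in $G$. Let $R$ be a semiprime ring with $1$ (not necessarily commutative) such that either $R$ has no torsion elements or, if $R$ has $p$-torsion elements for a prime $p$, then $p$ does not divide the order of any element of $G$. Let $\sigma,\tau$ be $R$-linear ring endomorphisms of the group ring $RG$ that fix the center $\mathcal{Z}(RG)$ pointwise. Then there is a ring $T$ containing $R$ such that $\mathcal{Z}(T)\supseteq\mathcal{Z}(R)$ and such that, for the natural $T$-linear extensions $\sigma_T,\tau_T$ of $\sigma,\tau$ to $TG$, one has $H^1(TG,{}_{\sigma_T}TG_{\tau_T})=0$; that is, every $T$-linear $(\sigma_T,\tau_T)$-derivation of $TG$ is $(\sigma_T,\tau_T)$-inner.
   Context: $\mathcal{Z}(\cdot)$ denotes the center (of a group or ring). An element $r\neq 0$ of the additive group of $R$ is $p$-torsion if $pr=0$; $R$ has no torsion elements if its additive group is torsion-free. $R$-linear means left $R$-linear: $\sigma(r\alpha)=r\sigma(\alpha)$. Under these hypotheses $\sigma(g),\tau(g)\in \mathcal{Z}(R)G\subseteq \mathcal{Z}(T)G$ for $g\in G$, and the natural extensions to $TG$ are $\sigma_T(\sum_g t_g g)=\sum_g t_g\sigma(g)$, $\tau_T(\sum_g t_g g)=\sum_g t_g\tau(g)$. For a ring $S$, a group $G$ and endomorphisms $\sigma,\tau$ of $SG$, an $S$-linear $(\sigma,\tau)$-derivation of $SG$ is an $S$-linear map $\delta:SG\to SG$ with $\delta(ab)=\delta(a)\tau(b)+\sigma(a)\delta(b)$ for all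 $a,b\in SG$. It is $(\sigma,\tau)$-inner if there is $x\in SG$ with $\delta(a)=x\tau(a)-\sigma(a)x$ for all $a\in SG$. ${}_\sigma SG_\tau$ denotes $SG$ viewed as an $SG$-$SG$-bimodule in which $a$ acts on the left by multiplication by $\sigma(a)$ and on the right by multiplication by $\tau(a)$. The notation $H^1(SG,{}_\sigma SG_\tau)=0$ means that every $S$-linear $(\sigma,\tau)$-derivation of $SG$ is $(\sigma,\tau)$-inner. *)

theory Defs
  imports "HOL-Computational_Algebra.Primes" "HOL-Algebra.Ideal_Product" "HOL-Algebra.Multiplicative_Group"
begin

text \<open>
  Since \<open>ring_scheme\<close> extends \<open>monoid_scheme\<close>, the following serves both for groups
  and for (the multiplication of) rings.
\<close>

definition center :: "('a, 'm) monoid_scheme \<Rightarrow> 'a set" where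
  "center M = {z \<in> carrier M. \<forall>x \<in> carrier M. z \<otimes>\<^bsub>M\<^esub> x = x \<otimes>\<^bsub>M\<^esub> z}"

definition torsion_group :: "('g, 'n) monoid_scheme \<Rightarrow> bool" where
  "torsion_group G \<longleftrightarrow>
     group G \<and> (\<forall>g \<in> carrier G. \<exists>n::nat. n > 0 \<and> g [^]\<^bsub>G\<^esub> n = \<one>\<^bsub>G\<^esub>)"

definition semiprime_ring :: "('r, 'm) ring_scheme \<Rightarrow> bool" where
  "semiprime_ring R \<longleftrightarrow>
     ring R \<and> (\<forall>I. ideal I R \<longrightarrow> I \<cdot>\<^bsub>R\<^esub> I = {\<zero>\<^bsub>R\<^esub>} \<longrightarrow> I = {\<zero>\<^bsub>R\<^esub>})"

definition torsion_free_ring :: "('r, 'm) ring_scheme \<Rightarrow> bool" where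
  "torsion_free_ring R \<longleftrightarrow>
     (\<forall>r \<in> carrier R. \<forall>n::nat. n > 0 \<longrightarrow> [n] \<cdot>\<^bsub>R\<^esub> r = \<zero>\<^bsub>R\<^esub> \<longrightarrow> r = \<zero>\<^bsub>R\<^esub>)"

definition has_p_torsion :: "nat \<Rightarrow> ('r, 'm) ring_scheme \<Rightarrow> bool" where
  "has_p_torsion p R \<longleftrightarrow>
     (\<exists>r \<in> carrier R. r \<noteq> \<zero>\<^bsub>R\<^esub> \<and> [p] \<cdot>\<^bsub>R\<^esub> r = \<zero>\<^bsub>R\<^esub>)"

definition group_elem :: "('r, 'm) ring_scheme \<Rightarrow> 'g \<Rightarrow> 'g \<Rightarrow> 'r" where
  "group_elem R g = (\<lambda>h. if h = g then \<one>\<^bsub>R\<^esub> else \<zero>\<^bsub>R\<^esub>)"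

text \<open>
  A formal sum is its coefficient function: finitely supported, and \<open>\<zero>\<close> outside
  \<open>carrier G\<close> so that equality of functions is equality in the group ring.
\<close>

definition group_ring ::
    "('r, 'm) ring_scheme \<Rightarrow> ('g, 'n) monoid_scheme \<Rightarrow> ('g \<Rightarrow> 'r) ring" where
  "group_ring R G =
     \<lparr> carrier = {f. (\<forall>g \<in> carrier G. f g \<in> carrier R)
                     \<and> (\<forall>g. g \<notin> carrier G \<longrightarrow> f g = \<zero>\<^bsub>R\<^esub>)
                     \<and> finite {g \<in> carrier G. f g \<noteq> \<zero>\<^bsub>R\<^esub>}},
       monoid.mult = (\<lambda>f h. \<lambda>g. if g \<in> carrier G
                 then (\<Oplus>\<^bsub>R\<^esub>k \<in> {k \<in> carrier G. f k \<noteq> \<zero>\<^bsub>R\<^esub>}. f k \<otimes>\<^bsub>R\<^esub> h (inv\<^bsub>G\<^esub> k \<otimes>\<^bsub>G\<^esub> g))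
                 else \<zero>\<^bsub>R\<^esub>),
       monoid.one = group_elem R \<one>\<^bsub>G\<^esub>,
       ring.zero = (\<lambda>g. \<zero>\<^bsub>R\<^esub>),
       ring.add = (\<lambda>f h. \<lambda>g. f g \<oplus>\<^bsub>R\<^esub> h g) \<rparr>"

definition scalar :: "('r, 'm) ring_scheme \<Rightarrow> 'r \<Rightarrow> ('g \<Rightarrow> 'r) \<Rightarrow> 'g \<Rightarrow> 'r" where
  "scalar R r f = (\<lambda>g. r \<otimes>\<^bsub>R\<^esub> f g)"

definition left_linear ::
    "('r, 'm) ring_scheme \<Rightarrow> ('g, 'n) monoid_scheme \<Rightarrow> (('g \<Rightarrow> 'r) \<Rightarrow> ('g \<Rightarrow> 'r)) \<Rightarrow> bool" where
  "left_linear R G \<phi> \<longleftrightarrow>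
     \<phi> \<in> carrier (group_ring R G) \<rightarrow> carrier (group_ring R G) \<and>
     (\<forall>a \<in> carrier (group_ring R G). \<forall>b \<in> carrier (group_ring R G).
        \<phi> (a \<oplus>\<^bsub>group_ring R G\<^esub> b) = \<phi> a \<oplus>\<^bsub>group_ring R G\<^esub> \<phi> b) \<and>
     (\<forall>r \<in> carrier R. \<forall>a \<in> carrier (group_ring R G).
        \<phi> (scalar R r a) = scalar R r (\<phi> a))"

definition linear_ring_endo ::
    "('r, 'm) ring_scheme \<Rightarrow> ('g, 'n) monoid_scheme \<Rightarrow> (('g \<Rightarrow> 'r) \<Rightarrow> ('g \<Rightarrow> 'r)) \<Rightarrow> bool" where
  "linear_ring_endo R G \<phi> \<longleftrightarrow>
     \<phi> \<in> ring_hom (group_ring R G) (group_ring R G) \<and> left_linear R G \<phi>"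

definition skew_derivation ::
    "('r, 'm) ring_scheme \<Rightarrow> ('g, 'n) monoid_scheme \<Rightarrow>
     (('g \<Rightarrow> 'r) \<Rightarrow> ('g \<Rightarrow> 'r)) \<Rightarrow> (('g \<Rightarrow> 'r) \<Rightarrow> ('g \<Rightarrow> 'r)) \<Rightarrow>
     (('g \<Rightarrow> 'r) \<Rightarrow> ('g \<Rightarrow> 'r)) \<Rightarrow> bool" where
  "skew_derivation S G \<sigma> \<tau> \<delta> \<longleftrightarrow>
     left_linear S G \<delta> \<and>
     (\<forall>a \<in> carrier (group_ring S G). \<forall>b \<in> carrier (group_ring S G).
        \<delta> (a \<otimes>\<^bsub>group_ring S G\<^esub> b) =
          (\<delta> a \<otimes>\<^bsub>group_ring S G\<^esub> \<tau> b) \<oplus>\<^bsub>group_ring S G\<^esub> (\<sigma> a \<otimes>\<^bsub>group_ring S G\<^esub> \<delta> b))"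

definition skew_inner ::
    "('r, 'm) ring_scheme \<Rightarrow> ('g, 'n) monoid_scheme \<Rightarrow>
     (('g \<Rightarrow> 'r) \<Rightarrow> ('g \<Rightarrow> 'r)) \<Rightarrow> (('g \<Rightarrow> 'r) \<Rightarrow> ('g \<Rightarrow> 'r)) \<Rightarrow>
     (('g \<Rightarrow> 'r) \<Rightarrow> ('g \<Rightarrow> 'r)) \<Rightarrow> bool" where
  "skew_inner S G \<sigma> \<tau> \<delta> \<longleftrightarrow>
     (\<exists>x \<in> carrier (group_ring S G). \<forall>a \<in> carrier (group_ring S G).
        \<delta> a = (x \<otimes>\<^bsub>group_ring S G\<^esub> \<tau> a) \<ominus>\<^bsub>group_ring S G\<^esub> (\<sigma> a \<otimes>\<^bsub>group_ring S G\<^esub> x))"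

text \<open>\<open>H\<^sup>1(SG, \<^sub>\<sigma>SG\<^sub>\<tau>) = 0\<close>:\<close>

definition H1_vanishes ::
    "('r, 'm) ring_scheme \<Rightarrow> ('g, 'n) monoid_scheme \<Rightarrow>
     (('g \<Rightarrow> 'r) \<Rightarrow> ('g \<Rightarrow> 'r)) \<Rightarrow> (('g \<Rightarrow> 'r) \<Rightarrow> ('g \<Rightarrow> 'r)) \<Rightarrow> bool" where
  "H1_vanishes S G \<sigma> \<tau> \<longleftrightarrow>
     (\<forall>\<delta>. skew_derivation S G \<sigma> \<tau> \<delta> \<longrightarrow> skew_inner S G \<sigma> \<tau> \<delta>)"

text \<open>
  An overring \<open>T\<close> of \<open>R\<close> lives on a type of its own, so the inclusion is an injective
  unital ring homomorphism \<open>\<iota>\<close>; \<open>\<iota> ` center R \<subseteq> center T\<close> is \<open>Z(R) \<subseteq> Z(T)\<close>.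
\<close>

definition ring_embedding ::
    "('r, 'm) ring_scheme \<Rightarrow> ('t, 'k) ring_scheme \<Rightarrow> ('r \<Rightarrow> 't) \<Rightarrow> bool" where
  "ring_embedding R T \<iota> \<longleftrightarrow> \<iota> \<in> ring_hom R T \<and> inj_on \<iota> (carrier R)"

text \<open>
  \<open>\<sigma>\<^sub>T (\<Sum> t\<^sub>g g) = \<Sum> t\<^sub>g \<sigma>(g)\<close>, where \<open>\<sigma>(g) \<in> RG\<close> is read in \<open>TG\<close> by applying \<open>\<iota>\<close>
  to its coefficients.
\<close>

definition extend_linear ::
    "('r, 'm) ring_scheme \<Rightarrow> ('t, 'k) ring_scheme \<Rightarrow> ('r \<Rightarrow> 't) \<Rightarrow> ('g, 'n) monoid_scheme \<Rightarrow>
     (('g \<Rightarrow> 'r) \<Rightarrow> ('g \<Rightarrow> 'r)) \<Rightarrow> ('g \<Rightarrow> 't) \<Rightarrow> ('g \<Rightarrow> 't)" where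
  "extend_linear R T \<iota> G \<sigma> f =
     (\<Oplus>\<^bsub>group_ring T G\<^esub>g \<in> {g \<in> carrier G. f g \<noteq> \<zero>\<^bsub>T\<^esub>}.
        scalar T (f g) (\<iota> \<circ> \<sigma> (group_elem R g)))"

end

theory Submission
  imports Defs "HOL-Algebra.Sylow"
begin

text \<open>
  Take for \<open>T\<close> the localization of \<open>R\<close> at the positive integers all of whose prime factors divide
  orders of elements of \<open>G\<close>; the torsion hypothesis says that \<open>R\<close> embeds into it. Let \<open>\<delta>\<close> be a
  derivation of \<open>TG\<close>. If \<open>z\<close> is central of order \<open>n\<close>, then \<open>0 = \<delta>(z\<^sup>n) = n z\<^sup>n\<^sup>-\<^sup>1 \<delta>(z)\<close>, so \<open>\<delta>(z) = 0\<close>.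
  Hence \<open>\<delta>(g) \<tau>(g\<^sup>-\<^sup>1)\<close> depends only on the coset of \<open>g\<close> modulo the center. By Cauchy's theorem the
  index of the center is invertible in \<open>T\<close>, and the average \<open>x\<close> of \<open>\<delta>(g) \<tau>(g\<^sup>-\<^sup>1)\<close> over the cosets
  satisfies \<open>\<delta>(h) = x \<tau>(h) - \<sigma>(h) x\<close>. Scalars commute with \<open>\<sigma>(g)\<close>, \<open>\<tau>(g)\<close> and \<open>\<delta>(g)\<close>, by applying
  the left linear maps to \<open>t g = g t\<close>, hence also with \<open>x\<close>; so the identity extends linearly to \<open>TG\<close>.
\<close>

text \<open>The ideal product would make \<open>[n] \<cdot> r\<close> ambiguous.\<close>

no_notation ideal_prod (infixl "\<cdot>\<index>" 80)

section \<open>Localization at a multiplicative set of positive integers\<close>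

text \<open>Integers commute with every ring element, so fractions with denominators in
  \<open>M\<close> can be formed as over a commutative ring although \<open>R\<close> is
  noncommutative. Since every member of \<open>M\<close> acts injectively on \<open>R\<close>, plain
  cross multiplication is an equivalence relation and \<open>R\<close> embeds.\<close>

locale integer_localization = ring R for R (structure) +
  fixes M :: "nat set"
  assumes one_mem: "1 \<in> M"
    and mult_mem: "\<lbrakk>n \<in> M; m \<in> M\<rbrakk> \<Longrightarrow> n * m \<in> M"
    and torsion_free: "\<lbrakk>n \<in> M; r \<in> carrier R; [n] \<cdot> r = \<zero>\<rbrakk> \<Longrightarrow> r = \<zero>"
begin

text \<open>The equivalence class of the pair \<open>(r, n)\<close> under cross multiplication,
  standing for r/n. Being a set of pairs, it makes the localization a ring on the type
  \<open>('a \<times> nat) set\<close>.\<close>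

definition fraction :: "'a \<Rightarrow> nat \<Rightarrow> ('a \<times> nat) set" where
  "fraction r n = {(s, m). s \<in> carrier R \<and> m \<in> M \<and> [m] \<cdot> r = [n] \<cdot> s}"

text \<open>Lifts an operation on pairs to classes through chosen representatives; the result is
  meaningful when \<open>f\<close> respects cross multiplication.\<close>

definition fraction_op :: "('a \<Rightarrow> nat \<Rightarrow> 'a \<Rightarrow> nat \<Rightarrow> ('a \<times> nat) set) \<Rightarrow>
    ('a \<times> nat) set \<Rightarrow> ('a \<times> nat) set \<Rightarrow> ('a \<times> nat) set" where
  "fraction_op f A B = (case (SOME p. p \<in> A, SOME q. q \<in> B) of ((r, n), (s, m)) \<Rightarrow> f r n s m)"

definition localization :: "('a \<times> nat) set ring" where
  "localization =
    \<lparr> carrier = {fraction r n | r n. r \<in> carrier R \<and> n \<in> M},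
      monoid.mult = fraction_op (\<lambda>r n s m. fraction (r \<otimes> s) (n * m)),
      monoid.one = fraction \<one> 1,
      ring.zero = fraction \<zero> 1,
      ring.add = fraction_op (\<lambda>r n s m. fraction ([m] \<cdot> r \<oplus> [n] \<cdot> s) (n * m)) \<rparr>"

section \<open>Equality of fractions and well-defined operations\<close>

lemma cancel:
  assumes "n \<in> M" "r \<in> carrier R" "s \<in> carrier R" "[n] \<cdot> r = [n] \<cdot> s"
  shows "r = s"
proof -
  have "[n] \<cdot> (r \<ominus> s) = [n] \<cdot> r \<ominus> [n] \<cdot> s"
    using assms by (simp add: a_minus_def add.nat_pow_distrib add.nat_pow_inv)
  then have "[n] \<cdot> (r \<ominus> s) = \<zero>" using assms by (simp add: a_minus_def r_neg)
  then have "r \<ominus> s = \<zero>" using assms torsion_free by blast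
  then show ?thesis using assms by simp
qed

lemma nmult_nmult: "r \<in> carrier R \<Longrightarrow> [n] \<cdot> ([m] \<cdot> r) = [(n * m :: nat)] \<cdot> r"
  by (simp add: add.nat_pow_pow mult.commute)

lemma nmult_mult:
  assumes "r \<in> carrier R" "s \<in> carrier R"
  shows "[n] \<cdot> r \<otimes> [m] \<cdot> s = [(n * m :: nat)] \<cdot> (r \<otimes> s)"
  using assms by (simp add: add_pow_ldistr add_pow_rdistr nmult_nmult mult.commute)

text \<open>From right to left this is transitivity of cross multiplication. The linking denominator
  \<open>n\<close> ends up on both sides and must be cancelled, which is where injectivity of
  multiplication by \<open>M\<close> enters.\<close>

lemma fraction_eq_iff:
  assumes "r \<in> carrier R" "s \<in> carrier R" "n \<in> M" "m \<in> M"
  shows "fraction r n = fraction s m \<longleftrightarrow> [m] \<cdot> r = [n] \<cdot> s"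
proof
  assume "fraction r n = fraction s m"
  moreover have "(r, n) \<in> fraction r n" using assms by (simp add: fraction_def)
  ultimately show "[m] \<cdot> r = [n] \<cdot> s" by (simp add: fraction_def)
next
  have *: "fraction r n \<subseteq> fraction s m"
    if rs: "r \<in> carrier R" "s \<in> carrier R" "n \<in> M" "m \<in> M" and eq: "[m] \<cdot> r = [n] \<cdot> s"
    for r s n m
  proof
    fix p assume "p \<in> fraction r n"
    then obtain u k where p: "p = (u, k)" "u \<in> carrier R" "k \<in> M" "[k] \<cdot> r = [n] \<cdot> u"
      by (auto simp: fraction_def)
    have "[n] \<cdot> ([k] \<cdot> s) = [k] \<cdot> ([n] \<cdot> s)" using rs(2) by (simp add: nmult_nmult mult.commute)
    also have "\<dots> = [m] \<cdot> ([k] \<cdot> r)"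
      unfolding eq[symmetric] using rs(1) by (simp add: nmult_nmult mult.commute)
    also have "\<dots> = [n] \<cdot> ([m] \<cdot> u)" using p(2) by (simp add: p(4) nmult_nmult mult.commute)
    finally have "[k] \<cdot> s = [m] \<cdot> u" using cancel[of n "[k] \<cdot> s" "[m] \<cdot> u"] rs(2,3) p(2) by simp
    with p show "p \<in> fraction s m" by (simp add: fraction_def)
  qed
  assume "[m] \<cdot> r = [n] \<cdot> s"
  then show "fraction r n = fraction s m"
    using assms by (intro equalityI *) simp_all
qed

text \<open>The classes are nonempty, so the chosen representatives lie in them and are equivalent
  to the given pairs; the last premise then makes the choice irrelevant.\<close>

lemma fraction_op_fraction:
  assumes "r \<in> carrier R" "s \<in> carrier R" "n \<in> M" "m \<in> M"
    and "\<And>r' n' s' m'. \<lbrakk>r' \<in> carrier R; s' \<in> carrier R; n' \<in> M; m' \<in> M;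
        [n'] \<cdot> r = [n] \<cdot> r'; [m'] \<cdot> s = [m] \<cdot> s'\<rbrakk> \<Longrightarrow> f r' n' s' m' = f r n s m"
  shows "fraction_op f (fraction r n) (fraction s m) = f r n s m"
proof -
  have "(r, n) \<in> fraction r n" "(s, m) \<in> fraction s m" using assms by (simp_all add: fraction_def)
  then have "(SOME p. p \<in> fraction r n) \<in> fraction r n"
    "(SOME p. p \<in> fraction s m) \<in> fraction s m"
    by (metis someI)+
  then obtain r' n' s' m' where
    "(SOME p. p \<in> fraction r n) = (r', n')" "(r', n') \<in> fraction r n"
    "(SOME p. p \<in> fraction s m) = (s', m')" "(s', m') \<in> fraction s m"
    by (metis surj_pair)
  then show ?thesis
    unfolding fraction_op_def using assms(5)[of r' s' n' m'] by (simp add: fraction_def)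
qed

lemma fraction_mult:
  assumes "r \<in> carrier R" "s \<in> carrier R" "n \<in> M" "m \<in> M"
  shows "fraction r n \<otimes>\<^bsub>localization\<^esub> fraction s m = fraction (r \<otimes> s) (n * m)"
  unfolding localization_def monoid.simps
proof (rule fraction_op_fraction[OF assms])
  fix r' n' s' m'
  assume *: "r' \<in> carrier R" "s' \<in> carrier R" "n' \<in> M" "m' \<in> M"
    "[n'] \<cdot> r = [n] \<cdot> r'" "[m'] \<cdot> s = [m] \<cdot> s'"
  have "[(n * m)] \<cdot> (r' \<otimes> s') = [(n' * m')] \<cdot> (r \<otimes> s)"
    using assms * nmult_mult[of r' s' n m] nmult_mult[of r s n' m'] by simp
  moreover have "r' \<otimes> s' \<in> carrier R" "r \<otimes> s \<in> carrier R" "n' * m' \<in> M" "n * m \<in> M"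
    using assms(1-4) *(1-4) by (simp_all add: mult_mem)
  ultimately show "fraction (r' \<otimes> s') (n' * m') = fraction (r \<otimes> s) (n * m)"
    by (simp only: fraction_eq_iff)
qed

lemma fraction_add:
  assumes "r \<in> carrier R" "s \<in> carrier R" "n \<in> M" "m \<in> M"
  shows "fraction r n \<oplus>\<^bsub>localization\<^esub> fraction s m = fraction ([m] \<cdot> r \<oplus> [n] \<cdot> s) (n * m)"
  unfolding localization_def ring.simps
proof (rule fraction_op_fraction[OF assms])
  fix r' n' s' m'
  assume *: "r' \<in> carrier R" "s' \<in> carrier R" "n' \<in> M" "m' \<in> M"
    "[n'] \<cdot> r = [n] \<cdot> r'" "[m'] \<cdot> s = [m] \<cdot> s'"
  \<comment> \<open>The two summands are compared separately, each using the equivalence of only one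
    of the two pairs.\<close>
  have "[(n * m)] \<cdot> ([m'] \<cdot> r') = [(m * m')] \<cdot> ([n] \<cdot> r')"
    using * by (simp add: nmult_nmult ac_simps)
  also have "\<dots> = [(n' * m')] \<cdot> ([m] \<cdot> r)"
    unfolding *(5)[symmetric] using assms by (simp add: nmult_nmult ac_simps)
  finally have 1: "[(n * m)] \<cdot> ([m'] \<cdot> r') = [(n' * m')] \<cdot> ([m] \<cdot> r)" .
  have "[(n * m)] \<cdot> ([n'] \<cdot> s') = [(n * n')] \<cdot> ([m] \<cdot> s')"
    using * by (simp add: nmult_nmult ac_simps)
  also have "\<dots> = [(n' * m')] \<cdot> ([n] \<cdot> s)"
    unfolding *(6)[symmetric] using assms by (simp add: nmult_nmult ac_simps)
  finally have 2: "[(n * m)] \<cdot> ([n'] \<cdot> s') = [(n' * m')] \<cdot> ([n] \<cdot> s)" .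
  have "[(n * m)] \<cdot> ([m'] \<cdot> r' \<oplus> [n'] \<cdot> s') = [(n' * m')] \<cdot> ([m] \<cdot> r \<oplus> [n] \<cdot> s)"
    using assms(1-4) *(1-4) by (simp add: add.nat_pow_distrib 1 2)
  moreover have "[m'] \<cdot> r' \<oplus> [n'] \<cdot> s' \<in> carrier R" "[m] \<cdot> r \<oplus> [n] \<cdot> s \<in> carrier R"
      "n' * m' \<in> M" "n * m \<in> M"
    using assms(1-4) *(1-4) by (simp_all add: mult_mem)
  ultimately show "fraction ([m'] \<cdot> r' \<oplus> [n'] \<cdot> s') (n' * m') = fraction ([m] \<cdot> r \<oplus> [n] \<cdot> s) (n * m)"
    by (simp only: fraction_eq_iff)
qed

section \<open>Ring axioms for the localization\<close>

lemma fraction_expand: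
  assumes "r \<in> carrier R" "n \<in> M" "m \<in> M"
  shows "fraction r n = fraction ([m] \<cdot> r) (n * m)"
  using assms by (simp only: fraction_eq_iff nmult_nmult mult_mem add.nat_pow_closed)

lemma fraction_add_same:
  assumes "r \<in> carrier R" "s \<in> carrier R" "n \<in> M"
  shows "fraction r n \<oplus>\<^bsub>localization\<^esub> fraction s n = fraction (r \<oplus> s) n"
  using assms fraction_expand[of "r \<oplus> s" n n] by (simp add: fraction_add add.nat_pow_distrib)

lemma carrier_localization: "carrier localization = {fraction r n | r n. r \<in> carrier R \<and> n \<in> M}"
  and zero_localization: "\<zero>\<^bsub>localization\<^esub> = fraction \<zero> 1"
  and one_localization: "\<one>\<^bsub>localization\<^esub> = fraction \<one> 1"
  by (simp_all add: localization_def)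

lemma fraction_closed: "r \<in> carrier R \<Longrightarrow> n \<in> M \<Longrightarrow> fraction r n \<in> carrier localization"
  unfolding carrier_localization by blast

lemma fraction_zero: "n \<in> M \<Longrightarrow> fraction \<zero> n = \<zero>\<^bsub>localization\<^esub>"
  using fraction_expand[of \<zero> 1 n] one_mem by (simp add: zero_localization)

text \<open>Three elements suffice because no ring axiom involves more. Over one denominator,
  addition is \<open>fraction_add_same\<close>, and the axioms reduce to those of \<open>R\<close>
  on numerators.\<close>

lemma common_denominator:
  assumes "x \<in> carrier localization" "y \<in> carrier localization" "z \<in> carrier localization"
  obtains r s t n where "r \<in> carrier R" "s \<in> carrier R" "t \<in> carrier R" "n \<in> M"
    "x = fraction r n" "y = fraction s n" "z = fraction t n"
proof -
  obtain r n s m t k where *: "r \<in> carrier R" "s \<in> carrier R" "t \<in> carrier R"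
      "n \<in> M" "m \<in> M" "k \<in> M" "x = fraction r n" "y = fraction s m" "z = fraction t k"
    using assms unfolding carrier_localization by blast
  have "x = fraction ([(m * k)] \<cdot> r) (n * m * k)" "y = fraction ([(n * k)] \<cdot> s) (n * m * k)"
    "z = fraction ([(n * m)] \<cdot> t) (n * m * k)"
    using * fraction_expand[of r n "m * k"] fraction_expand[of s m "n * k"] fraction_expand[of t k "n * m"]
    by (simp_all add: mult_mem ac_simps)
  from that[OF _ _ _ _ this] show ?thesis using *(1-6) by (simp add: mult_mem)
qed

lemma ring_localization: "ring localization"
proof (intro ringI abelian_groupI monoidI)
  fix x y z assume "x \<in> carrier localization" "y \<in> carrier localization" "z \<in> carrier localization"
  then obtain r s t n where "r \<in> carrier R" "s \<in> carrier R" "t \<in> carrier R" "n \<in> M"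
    "x = fraction r n" "y = fraction s n" "z = fraction t n"
    by (rule common_denominator)
  note * = this fraction_add_same fraction_closed fraction_mult mult_mem m_assoc l_distr r_distr a_assoc
  show "x \<oplus>\<^bsub>localization\<^esub> y \<oplus>\<^bsub>localization\<^esub> z = x \<oplus>\<^bsub>localization\<^esub> (y \<oplus>\<^bsub>localization\<^esub> z)"
    "x \<otimes>\<^bsub>localization\<^esub> y \<otimes>\<^bsub>localization\<^esub> z = x \<otimes>\<^bsub>localization\<^esub> (y \<otimes>\<^bsub>localization\<^esub> z)"
    "(x \<oplus>\<^bsub>localization\<^esub> y) \<otimes>\<^bsub>localization\<^esub> z =
      x \<otimes>\<^bsub>localization\<^esub> z \<oplus>\<^bsub>localization\<^esub> y \<otimes>\<^bsub>localization\<^esub> z"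
    "z \<otimes>\<^bsub>localization\<^esub> (x \<oplus>\<^bsub>localization\<^esub> y) =
      z \<otimes>\<^bsub>localization\<^esub> x \<oplus>\<^bsub>localization\<^esub> z \<otimes>\<^bsub>localization\<^esub> y"
    using * by (simp_all add: mult.assoc)
next
  fix x y assume "x \<in> carrier localization" "y \<in> carrier localization"
  then obtain r s n where "r \<in> carrier R" "s \<in> carrier R" "n \<in> M" "x = fraction r n" "y = fraction s n"
    using common_denominator[of x y x] by metis
  note * = this fraction_add_same fraction_closed fraction_mult mult_mem one_mem
  show "x \<oplus>\<^bsub>localization\<^esub> y \<in> carrier localization"
    "x \<otimes>\<^bsub>localization\<^esub> y \<in> carrier localization"
    using * by simp_all
  show "x \<oplus>\<^bsub>localization\<^esub> y = y \<oplus>\<^bsub>localization\<^esub> x" using * by (simp add: a_comm)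
  show "\<one>\<^bsub>localization\<^esub> \<otimes>\<^bsub>localization\<^esub> x = x" "x \<otimes>\<^bsub>localization\<^esub> \<one>\<^bsub>localization\<^esub> = x"
    using * fraction_mult[of \<one> r 1 n] fraction_mult[of r \<one> n 1] by (simp_all add: one_localization)
  \<comment> \<open>Zero is rewritten with the denominator \<open>n\<close> of \<open>x\<close>, so
    that numerators can be added directly.\<close>
  show "\<zero>\<^bsub>localization\<^esub> \<oplus>\<^bsub>localization\<^esub> x = x"
    using * by (simp flip: fraction_zero[of n])
  show "\<exists>y\<in>carrier localization. y \<oplus>\<^bsub>localization\<^esub> x = \<zero>\<^bsub>localization\<^esub>"
    using * by (intro bexI[of _ "fraction (\<ominus> r) n"]) (simp_all add: l_neg fraction_zero)
next
  show "\<zero>\<^bsub>localization\<^esub> \<in> carrier localization" "\<one>\<^bsub>localization\<^esub> \<in> carrier localization"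
    by (simp_all only: zero_localization one_localization fraction_closed zero_closed one_closed one_mem)
qed

section \<open>Division by denominators, and the embedding of the base ring\<close>

lemma fraction_nmult:
  assumes "r \<in> carrier R" "n \<in> M"
  shows "[(k::nat)] \<cdot>\<^bsub>localization\<^esub> fraction r n = fraction ([k] \<cdot> r) n"
proof (induction k)
  interpret L: ring localization by (rule ring_localization)
  case 0
  show ?case using assms by (simp add: fraction_zero)
next
  interpret L: ring localization by (rule ring_localization)
  case (Suc k)
  then show ?case using assms by (simp add: fraction_add_same)
qed

text \<open>A quotient is found by multiplying the denominator by \<open>k\<close>. Existence later
  supplies the inverse of the index of the center, and uniqueness supplies cancellation of integers
  in \<open>M\<close>.\<close>

lemma localization_divisible:
  assumes "k \<in> M" "x \<in> carrier localization"
  shows "\<exists>!y. y \<in> carrier localization \<and> [k] \<cdot>\<^bsub>localization\<^esub> y = x"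
proof -
  obtain r n where x: "x = fraction r n" "r \<in> carrier R" "n \<in> M"
    using assms unfolding carrier_localization by blast
  show ?thesis
  proof (rule ex1I[of _ "fraction r (n * k)"])
    show "fraction r (n * k) \<in> carrier localization \<and> [k] \<cdot>\<^bsub>localization\<^esub> fraction r (n * k) = x"
      using x assms by (simp add: fraction_nmult fraction_closed mult_mem fraction_expand[of r n k])
  next
    fix y assume y: "y \<in> carrier localization \<and> [k] \<cdot>\<^bsub>localization\<^esub> y = x"
    then obtain s m where s: "y = fraction s m" "s \<in> carrier R" "m \<in> M"
      unfolding carrier_localization by blast
    with y x have "fraction ([k] \<cdot> s) m = fraction r n" by (simp add: fraction_nmult)
    then have "[n] \<cdot> ([k] \<cdot> s) = [m] \<cdot> r" using s x by (subst (asm) fraction_eq_iff) auto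
    then show "y = fraction r (n * k)"
      unfolding s(1) using s x assms by (subst fraction_eq_iff) (auto simp: mult_mem nmult_nmult)
  qed
qed

lemma localization_embedding: "ring_embedding R localization (\<lambda>r. fraction r 1)"
  unfolding ring_embedding_def ring_hom_def inj_on_def
  using fraction_eq_iff[of _ _ 1 1] fraction_mult[of _ _ 1 1] one_mem
  by (auto simp: fraction_closed fraction_add_same one_localization)

text \<open>A central numerator commutes with every numerator, and denominators, being integers,
  commute anyway.\<close>

lemma localization_center: "(\<lambda>r. fraction r 1) ` center R \<subseteq> center localization"
  unfolding center_def carrier_localization
  using one_mem by (auto simp: fraction_mult mult.commute)

end

section \<open>Group rings\<close>

locale group_algebra = R?: ring R + G?: group G
  for R :: "('r, 'm) ring_scheme" (structure) and G :: "('g, 'n) monoid_scheme" (structure)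
begin

abbreviation RG :: "('g \<Rightarrow> 'r) ring" where "RG \<equiv> group_ring R G"

definition supp :: "('g \<Rightarrow> 'r) \<Rightarrow> 'g set" where
  "supp f = {g \<in> carrier G. f g \<noteq> \<zero>\<^bsub>R\<^esub>}"

definition monomial :: "'r \<Rightarrow> 'g \<Rightarrow> 'g \<Rightarrow> 'r" where
  "monomial r g = (\<lambda>h. if h = g then r else \<zero>\<^bsub>R\<^esub>)"

section \<open>Coefficients, supports and the additive group\<close>

lemma monomial_apply: "monomial r g h = (if h = g then r else \<zero>\<^bsub>R\<^esub>)"
  by (simp add: monomial_def)

lemma group_elem_eq: "group_elem R g = monomial \<one>\<^bsub>R\<^esub> g"
  by (simp add: group_elem_def monomial_def)

lemma in_carrier_iff: "f \<in> carrier RG \<longleftrightarrow>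
    (\<forall>g\<in>carrier G. f g \<in> carrier R) \<and> (\<forall>g. g \<notin> carrier G \<longrightarrow> f g = \<zero>\<^bsub>R\<^esub>) \<and> finite (supp f)"
  by (simp add: group_ring_def supp_def)

lemma mult_outside: "g \<notin> carrier G \<Longrightarrow> (f \<otimes>\<^bsub>RG\<^esub> h) g = \<zero>\<^bsub>R\<^esub>"
  by (simp add: group_ring_def)

lemma mult_eq: "g \<in> carrier G \<Longrightarrow>
    (f \<otimes>\<^bsub>RG\<^esub> h) g = (\<Oplus>\<^bsub>R\<^esub>k\<in>supp f. f k \<otimes>\<^bsub>R\<^esub> h (inv\<^bsub>G\<^esub> k \<otimes>\<^bsub>G\<^esub> g))"
  by (simp add: group_ring_def supp_def)

lemma add_apply: "(f \<oplus>\<^bsub>RG\<^esub> h) g = f g \<oplus>\<^bsub>R\<^esub> h g"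
  and zero_apply: "\<zero>\<^bsub>RG\<^esub> g = \<zero>\<^bsub>R\<^esub>"
  and one_eq: "\<one>\<^bsub>RG\<^esub> = monomial \<one>\<^bsub>R\<^esub> \<one>\<^bsub>G\<^esub>"
  by (simp_all add: group_ring_def group_elem_eq)

lemma coeff_closed [simp]: "f \<in> carrier RG \<Longrightarrow> f g \<in> carrier R"
  by (cases "g \<in> carrier G") (auto simp: in_carrier_iff)

lemma zero_outside: "f \<in> carrier RG \<Longrightarrow> g \<notin> carrier G \<Longrightarrow> f g = \<zero>\<^bsub>R\<^esub>"
  unfolding in_carrier_iff by blast

lemma coeff_outside: "f \<in> carrier RG \<Longrightarrow> g \<notin> supp f \<Longrightarrow> f g = \<zero>\<^bsub>R\<^esub>"
  unfolding in_carrier_iff supp_def by blast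

lemma finite_supp [simp]: "f \<in> carrier RG \<Longrightarrow> finite (supp f)"
  unfolding in_carrier_iff by blast

lemma supp_subset: "supp f \<subseteq> carrier G"
  by (auto simp: supp_def)

lemma in_carrierI:
  assumes "\<And>g. f g \<in> carrier R" "finite F" "F \<subseteq> carrier G" "\<And>g. g \<notin> F \<Longrightarrow> f g = \<zero>\<^bsub>R\<^esub>"
  shows "f \<in> carrier RG"
proof -
  have "supp f \<subseteq> F" using assms by (auto simp: supp_def)
  with assms show ?thesis unfolding in_carrier_iff by (meson finite_subset subsetD)
qed

lemma monomial_closed [simp]: "r \<in> carrier R \<Longrightarrow> g \<in> carrier G \<Longrightarrow> monomial r g \<in> carrier RG"
  by (rule in_carrierI[of _ "{g}"]) (auto simp: monomial_def)

lemma scalar_closed [simp]: "r \<in> carrier R \<Longrightarrow> f \<in> carrier RG \<Longrightarrow> scalar R r f \<in> carrier RG"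
  by (rule in_carrierI[of _ "supp f"]) (auto simp: scalar_def coeff_outside supp_subset[THEN subsetD])

lemma scalar_monomial:
  "r \<in> carrier R \<Longrightarrow> s \<in> carrier R \<Longrightarrow> scalar R r (monomial s g) = monomial (r \<otimes>\<^bsub>R\<^esub> s) g"
  by (auto simp: scalar_def monomial_def)

lemma group_ring_add_closed:
  assumes "f \<in> carrier RG" "h \<in> carrier RG" shows "f \<oplus>\<^bsub>RG\<^esub> h \<in> carrier RG"
  using assms
  by (intro in_carrierI[of _ "supp f \<union> supp h"]) (auto simp: add_apply coeff_outside supp_subset[THEN subsetD])

lemma group_ring_abelian_group: "abelian_group RG"
proof (rule abelian_groupI)
  fix f assume f: "f \<in> carrier RG"
  show "\<exists>h\<in>carrier RG. h \<oplus>\<^bsub>RG\<^esub> f = \<zero>\<^bsub>RG\<^esub>"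
  proof (rule bexI)
    show "(\<lambda>g. \<ominus>\<^bsub>R\<^esub> f g) \<oplus>\<^bsub>RG\<^esub> f = \<zero>\<^bsub>RG\<^esub>"
      using f by (auto simp: add_apply zero_apply l_neg)
    show "(\<lambda>g. \<ominus>\<^bsub>R\<^esub> f g) \<in> carrier RG"
      using f by (intro in_carrierI[of _ "supp f"]) (auto simp: coeff_outside supp_subset[THEN subsetD])
  qed
next
  show "\<zero>\<^bsub>RG\<^esub> \<in> carrier RG" by (intro in_carrierI[of _ "{}"]) (auto simp: zero_apply)
qed (auto simp: group_ring_add_closed add_apply zero_apply a_ac)

text \<open>Terms outside the support vanish, so the convolution may be summed over any larger
  finite set; this puts products with different left factors over a common index set.\<close>

lemma mult_apply:
  assumes "f \<in> carrier RG" "h \<in> carrier RG" "g \<in> carrier G"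
    and "finite F" "supp f \<subseteq> F"
  shows "(f \<otimes>\<^bsub>RG\<^esub> h) g = (\<Oplus>\<^bsub>R\<^esub>k\<in>F. f k \<otimes>\<^bsub>R\<^esub> h (inv\<^bsub>G\<^esub> k \<otimes>\<^bsub>G\<^esub> g))"
proof -
  have "(\<Oplus>\<^bsub>R\<^esub>k\<in>supp f. f k \<otimes>\<^bsub>R\<^esub> h (inv\<^bsub>G\<^esub> k \<otimes>\<^bsub>G\<^esub> g)) = (\<Oplus>\<^bsub>R\<^esub>k\<in>F. f k \<otimes>\<^bsub>R\<^esub> h (inv\<^bsub>G\<^esub> k \<otimes>\<^bsub>G\<^esub> g))"
    using assms by (intro add.finprod_mono_neutral_cong_left) (auto simp: coeff_outside)
  then show ?thesis using assms(3) by (simp only: mult_eq)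
qed

lemma mult_closed:
  assumes f: "f \<in> carrier RG" and h: "h \<in> carrier RG"
  shows "f \<otimes>\<^bsub>RG\<^esub> h \<in> carrier RG"
proof (rule in_carrierI)
  \<comment> \<open>The support of a product lies in the set of products of support elements: a
    nonzero term for \<open>k\<close> at \<open>g\<close> forces \<open>inv k \<otimes> g\<close>
    into the support of \<open>h\<close>, and
    \<open>g = k \<otimes> (inv k \<otimes> g)\<close>.\<close>
  show "finite ((\<lambda>(k, l). k \<otimes>\<^bsub>G\<^esub> l) ` (supp f \<times> supp h))" using f h by simp
  show "(\<lambda>(k, l). k \<otimes>\<^bsub>G\<^esub> l) ` (supp f \<times> supp h) \<subseteq> carrier G"
    by (auto dest!: supp_subset[THEN subsetD])
  show "(f \<otimes>\<^bsub>RG\<^esub> h) g \<in> carrier R" for g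
    using f h mult_apply[OF f h _ _ order_refl, of g]
    by (cases "g \<in> carrier G") (auto simp: mult_outside intro!: finsum_closed)
  show "(f \<otimes>\<^bsub>RG\<^esub> h) g = \<zero>\<^bsub>R\<^esub>" if g: "g \<notin> (\<lambda>(k, l). k \<otimes>\<^bsub>G\<^esub> l) ` (supp f \<times> supp h)" for g
  proof (cases "g \<in> carrier G")
    case True
    have "h (inv\<^bsub>G\<^esub> k \<otimes>\<^bsub>G\<^esub> g) = \<zero>\<^bsub>R\<^esub>" if k: "k \<in> supp f" for k
    proof (rule ccontr)
      assume "h (inv\<^bsub>G\<^esub> k \<otimes>\<^bsub>G\<^esub> g) \<noteq> \<zero>\<^bsub>R\<^esub>"
      with h have "inv\<^bsub>G\<^esub> k \<otimes>\<^bsub>G\<^esub> g \<in> supp h" by (metis coeff_outside)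
      moreover have "g = k \<otimes>\<^bsub>G\<^esub> (inv\<^bsub>G\<^esub> k \<otimes>\<^bsub>G\<^esub> g)"
        using True k supp_subset by (metis G.inv_solve_left G.inv_closed G.m_closed subsetD)
      ultimately show False using g k by force
    qed
    then show ?thesis
      using f h True mult_apply[OF f h True _ order_refl] by (simp cong: finsum_cong)
  qed (simp add: mult_outside)
qed

text \<open>Identifies the scalar \<open>r\<close> with the ring element
  \<open>monomial r \<one>\<close>, so that linearity can be handled by ring arithmetic. The left
  factor is supported in the identity, which leaves one term of the convolution.\<close>

lemma scalar_eq_mult:
  assumes "r \<in> carrier R" "f \<in> carrier RG"
  shows "scalar R r f = monomial r \<one>\<^bsub>G\<^esub> \<otimes>\<^bsub>RG\<^esub> f"
proof
  fix g show "scalar R r f g = (monomial r \<one>\<^bsub>G\<^esub> \<otimes>\<^bsub>RG\<^esub> f) g"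
  proof (cases "g \<in> carrier G")
    case True
    then show ?thesis using assms
      by (subst mult_apply[where F="{\<one>\<^bsub>G\<^esub>}"]) (auto simp: supp_def monomial_apply scalar_def)
  next
    case False
    then show ?thesis using assms by (simp add: mult_outside scalar_def zero_outside)
  qed
qed

lemma mult_monomial_one:
  assumes "r \<in> carrier R" "f \<in> carrier RG"
  shows "(f \<otimes>\<^bsub>RG\<^esub> monomial r \<one>\<^bsub>G\<^esub>) g = f g \<otimes>\<^bsub>R\<^esub> r"
proof (cases "g \<in> carrier G")
  case True
  \<comment> \<open>Only the term \<open>k = g\<close> survives; \<open>g\<close> is inserted into
    the index set because it may lie outside the support of \<open>f\<close>.\<close>
  have *: "inv\<^bsub>G\<^esub> k \<otimes>\<^bsub>G\<^esub> g = \<one>\<^bsub>G\<^esub> \<longleftrightarrow> k = g" if "k \<in> insert g (supp f)" for k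
    using that True supp_subset[of f] by (metis G.inv_closed G.inv_equality G.inv_inv G.l_inv insertE subsetD)
  have "(f \<otimes>\<^bsub>RG\<^esub> monomial r \<one>\<^bsub>G\<^esub>) g
      = (\<Oplus>\<^bsub>R\<^esub>k\<in>insert g (supp f). f k \<otimes>\<^bsub>R\<^esub> monomial r \<one>\<^bsub>G\<^esub> (inv\<^bsub>G\<^esub> k \<otimes>\<^bsub>G\<^esub> g))"
    using True assms by (subst mult_apply) auto
  also have "\<dots> = (\<Oplus>\<^bsub>R\<^esub>k\<in>insert g (supp f). if g = k then f k \<otimes>\<^bsub>R\<^esub> r else \<zero>\<^bsub>R\<^esub>)"
    using True assms by (intro finsum_cong') (auto simp: monomial_def *)
  also have "\<dots> = f g \<otimes>\<^bsub>R\<^esub> r"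
    using True assms by (intro finsum_singleton) auto
  finally show ?thesis .
next
  case False
  then show ?thesis using assms by (simp add: mult_outside zero_outside)
qed

lemma monomial_mult:
  assumes "r \<in> carrier R" "s \<in> carrier R" "g \<in> carrier G" "h \<in> carrier G"
  shows "monomial r g \<otimes>\<^bsub>RG\<^esub> monomial s h = monomial (r \<otimes>\<^bsub>R\<^esub> s) (g \<otimes>\<^bsub>G\<^esub> h)"
proof
  fix k show "(monomial r g \<otimes>\<^bsub>RG\<^esub> monomial s h) k = monomial (r \<otimes>\<^bsub>R\<^esub> s) (g \<otimes>\<^bsub>G\<^esub> h) k"
  proof (cases "k \<in> carrier G")
    case True
    have "inv\<^bsub>G\<^esub> g \<otimes>\<^bsub>G\<^esub> k = h \<longleftrightarrow> k = g \<otimes>\<^bsub>G\<^esub> h"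
      using True assms by (metis G.inv_solve_left')
    then show ?thesis using True assms
      by (subst mult_apply[where F="{g}"]) (auto simp: supp_def monomial_apply)
  next
    case False
    then show ?thesis using assms by (auto simp: mult_outside monomial_apply)
  qed
qed

lemma group_ring_l_distr:
  assumes "a \<in> carrier RG" "b \<in> carrier RG" "c \<in> carrier RG"
  shows "(a \<oplus>\<^bsub>RG\<^esub> b) \<otimes>\<^bsub>RG\<^esub> c = a \<otimes>\<^bsub>RG\<^esub> c \<oplus>\<^bsub>RG\<^esub> b \<otimes>\<^bsub>RG\<^esub> c"
proof
  fix g show "((a \<oplus>\<^bsub>RG\<^esub> b) \<otimes>\<^bsub>RG\<^esub> c) g = (a \<otimes>\<^bsub>RG\<^esub> c \<oplus>\<^bsub>RG\<^esub> b \<otimes>\<^bsub>RG\<^esub> c) g"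
  proof (cases "g \<in> carrier G")
    case True
    have "supp (a \<oplus>\<^bsub>RG\<^esub> b) \<subseteq> supp a \<union> supp b"
      using assms by (auto simp: supp_def add_apply)
    with True assms show ?thesis
      by (simp add: add_apply group_ring_add_closed mult_apply[where F="supp a \<union> supp b"]
          l_distr finsum_addf Pi_def)
  qed (simp add: add_apply mult_outside)
qed

lemma group_ring_r_distr:
  assumes "a \<in> carrier RG" "b \<in> carrier RG" "c \<in> carrier RG"
  shows "c \<otimes>\<^bsub>RG\<^esub> (a \<oplus>\<^bsub>RG\<^esub> b) = c \<otimes>\<^bsub>RG\<^esub> a \<oplus>\<^bsub>RG\<^esub> c \<otimes>\<^bsub>RG\<^esub> b"
proof
  fix g show "(c \<otimes>\<^bsub>RG\<^esub> (a \<oplus>\<^bsub>RG\<^esub> b)) g = (c \<otimes>\<^bsub>RG\<^esub> a \<oplus>\<^bsub>RG\<^esub> c \<otimes>\<^bsub>RG\<^esub> b) g"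
  proof (cases "g \<in> carrier G")
    case True
    with assms show ?thesis
      by (simp add: add_apply group_ring_add_closed mult_apply[where F="supp c"]
          r_distr finsum_addf Pi_def)
  qed (simp add: add_apply mult_outside)
qed

text \<open>Every element is a finite sum of monomials, split off one coefficient at a time by
  induction on a finite set containing the support. Additive statements thus reduce to
  monomials.\<close>

lemma group_ring_induct [consumes 1, case_names monomial add]:
  assumes f: "f \<in> carrier RG"
    and monomial: "\<And>r g. \<lbrakk>r \<in> carrier R; g \<in> carrier G\<rbrakk> \<Longrightarrow> P (monomial r g)"
    and add: "\<And>a b. \<lbrakk>a \<in> carrier RG; b \<in> carrier RG; P a; P b\<rbrakk> \<Longrightarrow> P (a \<oplus>\<^bsub>RG\<^esub> b)"
  shows "P f"
proof -
  have "\<forall>f\<in>carrier RG. supp f \<subseteq> F \<longrightarrow> P f" if "finite F" "F \<subseteq> carrier G" for F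
    using that
  proof (induction F rule: finite_induct)
    case empty
    \<comment> \<open>The zero element is covered by the monomial case with coefficient
      zero.\<close>
    have "f = monomial \<zero>\<^bsub>R\<^esub> \<one>\<^bsub>G\<^esub>" if "f \<in> carrier RG" "supp f \<subseteq> {}" for f
      using that coeff_outside[of f] by (force simp: monomial_def)
    then show ?case using monomial[of "\<zero>\<^bsub>R\<^esub>" "\<one>\<^bsub>G\<^esub>"] by auto
  next
    case (insert k F)
    show ?case
    proof (intro ballI impI)
      fix f assume f: "f \<in> carrier RG" "supp f \<subseteq> insert k F"
      define h where "h = f(k := \<zero>\<^bsub>R\<^esub>)"
      have h: "h \<in> carrier RG"
        using f by (intro in_carrierI[of _ "supp f"])
          (auto simp: h_def coeff_outside supp_subset[THEN subsetD])
      moreover have "supp h \<subseteq> F" using f by (auto simp: h_def supp_def split: if_splits)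
      ultimately have "P h" using insert by auto
      have "monomial (f k) k \<oplus>\<^bsub>RG\<^esub> h = f"
        using f by (auto simp: add_apply monomial_def h_def)
      then show "P f"
        using add[of "monomial (f k) k" h] monomial[of "f k" k] \<open>P h\<close> h f insert.prems by auto
    qed
  qed
  from this[of "supp f"] show ?thesis using f supp_subset by simp
qed

lemma group_ring_ring: "ring RG"
proof (intro ringI group_ring_abelian_group monoidI)
  note closed = mult_closed group_ring_add_closed
  fix a b c assume "a \<in> carrier RG" "b \<in> carrier RG" "c \<in> carrier RG"
  then show "a \<otimes>\<^bsub>RG\<^esub> b \<otimes>\<^bsub>RG\<^esub> c = a \<otimes>\<^bsub>RG\<^esub> (b \<otimes>\<^bsub>RG\<^esub> c)"
  \<comment> \<open>Both sides are additive in each factor, so three nested inductions leave only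
    monomials, where the law splits into associativity in \<open>R\<close> and in
    \<open>G\<close>.\<close>
  proof (induction a arbitrary: b c rule: group_ring_induct)
    case (monomial r g)
    from monomial(3,1,2,4) show ?case
    proof (induction b arbitrary: c rule: group_ring_induct)
      case (monomial s h)
      from monomial(5,1-4) show ?case
      proof (induction c rule: group_ring_induct)
        case (monomial t k)
        then show ?case by (simp add: monomial_mult R.m_assoc G.m_assoc)
      next
        case (add a b)
        then show ?case by (simp add: group_ring_r_distr closed)
      qed
    next
      case (add a b)
      then show ?case by (simp add: group_ring_l_distr group_ring_r_distr closed)
    qed
  next
    case (add a b)
    then show ?case by (simp add: group_ring_l_distr closed)
  qed
next
  fix a assume a: "a \<in> carrier RG"
  show "\<one>\<^bsub>RG\<^esub> \<otimes>\<^bsub>RG\<^esub> a = a"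
    unfolding one_eq using a scalar_eq_mult[of "\<one>\<^bsub>R\<^esub>" a] by (simp add: scalar_def)
  show "a \<otimes>\<^bsub>RG\<^esub> \<one>\<^bsub>RG\<^esub> = a"
    unfolding one_eq using a mult_monomial_one[of "\<one>\<^bsub>R\<^esub>" a] by auto
next
  show "\<one>\<^bsub>RG\<^esub> \<in> carrier RG" by (simp add: one_eq)
qed (auto simp: mult_closed group_ring_l_distr group_ring_r_distr)

sublocale RG: ring RG
  by (rule group_ring_ring)

end

section \<open>Linear extensions of maps on the group\<close>

context group_algebra
begin

section \<open>Scalar multiplication, central coefficients and linear extension\<close>

lemma scalar_add:
  "\<lbrakk>r \<in> carrier R; a \<in> carrier RG; b \<in> carrier RG\<rbrakk> \<Longrightarrow>
    scalar R r (a \<oplus>\<^bsub>RG\<^esub> b) = scalar R r a \<oplus>\<^bsub>RG\<^esub> scalar R r b"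
  by (simp add: scalar_eq_mult RG.r_distr)

lemma scalar_scalar:
  "\<lbrakk>r \<in> carrier R; s \<in> carrier R; a \<in> carrier RG\<rbrakk> \<Longrightarrow>
    scalar R r (scalar R s a) = scalar R (r \<otimes>\<^bsub>R\<^esub> s) a"
  by (simp add: scalar_def R.m_assoc)

lemma scalar_plus:
  "\<lbrakk>r \<in> carrier R; s \<in> carrier R; a \<in> carrier RG\<rbrakk> \<Longrightarrow>
    scalar R (r \<oplus>\<^bsub>R\<^esub> s) a = scalar R r a \<oplus>\<^bsub>RG\<^esub> scalar R s a"
  by (auto simp: scalar_def R.l_distr add_apply)

lemma scalar_zero: "a \<in> carrier RG \<Longrightarrow> scalar R \<zero>\<^bsub>R\<^esub> a = \<zero>\<^bsub>RG\<^esub>"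
  by (auto simp: scalar_def zero_apply)

lemma scalar_one: "a \<in> carrier RG \<Longrightarrow> scalar R \<one>\<^bsub>R\<^esub> a = a"
  by (auto simp: scalar_def)

lemma supp_monomial: "supp (monomial r g) \<subseteq> {g}"
  by (auto simp: supp_def monomial_apply)

text \<open>Multiplying by \<open>monomial r \<one>\<close> on the left or right multiplies each
  coefficient by \<open>r\<close> on that side, so the commutation can be read off
  coefficientwise.\<close>

lemma coeff_center_iff:
  assumes "f \<in> carrier RG"
  shows "(\<forall>g. f g \<in> center R) \<longleftrightarrow>
    (\<forall>r\<in>carrier R. monomial r \<one>\<^bsub>G\<^esub> \<otimes>\<^bsub>RG\<^esub> f = f \<otimes>\<^bsub>RG\<^esub> monomial r \<one>\<^bsub>G\<^esub>)"
proof -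
  have "(monomial r \<one>\<^bsub>G\<^esub> \<otimes>\<^bsub>RG\<^esub> f = f \<otimes>\<^bsub>RG\<^esub> monomial r \<one>\<^bsub>G\<^esub>) \<longleftrightarrow>
      (\<forall>g. r \<otimes>\<^bsub>R\<^esub> f g = f g \<otimes>\<^bsub>R\<^esub> r)" if "r \<in> carrier R" for r
    using that assms by (simp add: fun_eq_iff mult_monomial_one scalar_def flip: scalar_eq_mult)
  then show ?thesis using assms unfolding center_def by (auto simp: eq_commute)
qed

text \<open>The left linear map on the group ring prescribed by \<open>u\<close> on group elements;
  \<open>extend_linear\<close> is the instance where \<open>u g\<close> is \<sigma>(g) read over the
  larger ring.\<close>

definition lin_ext :: "('g \<Rightarrow> 'g \<Rightarrow> 'r) \<Rightarrow> ('g \<Rightarrow> 'r) \<Rightarrow> 'g \<Rightarrow> 'r" where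
  "lin_ext u f = (\<Oplus>\<^bsub>RG\<^esub>g\<in>supp f. scalar R (f g) (u g))"

context
  fixes u :: "'g \<Rightarrow> 'g \<Rightarrow> 'r"
  assumes u: "\<And>g. g \<in> carrier G \<Longrightarrow> u g \<in> carrier RG"
begin

lemma lin_ext_superset:
  assumes "f \<in> carrier RG" "finite F" "supp f \<subseteq> F" "F \<subseteq> carrier G"
  shows "lin_ext u f = (\<Oplus>\<^bsub>RG\<^esub>g\<in>F. scalar R (f g) (u g))"
  unfolding lin_ext_def using assms
  by (intro RG.add.finprod_mono_neutral_cong_left) (auto simp: coeff_outside scalar_zero u subset_iff)

lemma lin_ext_closed:
  assumes "f \<in> carrier RG" shows "lin_ext u f \<in> carrier RG"
  unfolding lin_ext_def using assms u supp_subset[of f] by (auto intro!: RG.finsum_closed)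

lemma lin_ext_add:
  assumes "a \<in> carrier RG" "b \<in> carrier RG"
  shows "lin_ext u (a \<oplus>\<^bsub>RG\<^esub> b) = lin_ext u a \<oplus>\<^bsub>RG\<^esub> lin_ext u b"
proof -
  let ?F = "supp a \<union> supp b"
  have F: "finite ?F" "?F \<subseteq> carrier G" using assms supp_subset by auto
  have "supp (a \<oplus>\<^bsub>RG\<^esub> b) \<subseteq> ?F" using assms by (auto simp: supp_def add_apply)
  then have "lin_ext u (a \<oplus>\<^bsub>RG\<^esub> b) = (\<Oplus>\<^bsub>RG\<^esub>g\<in>?F. scalar R ((a \<oplus>\<^bsub>RG\<^esub> b) g) (u g))"
    using assms F by (intro lin_ext_superset) auto
  also have "\<dots> = (\<Oplus>\<^bsub>RG\<^esub>g\<in>?F. scalar R (a g) (u g) \<oplus>\<^bsub>RG\<^esub> scalar R (b g) (u g))"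
    using assms F u by (intro RG.finsum_cong') (auto simp: add_apply scalar_plus subset_iff)
  also have "\<dots> = (\<Oplus>\<^bsub>RG\<^esub>g\<in>?F. scalar R (a g) (u g)) \<oplus>\<^bsub>RG\<^esub> (\<Oplus>\<^bsub>RG\<^esub>g\<in>?F. scalar R (b g) (u g))"
    using assms F u by (intro RG.finsum_addf) (auto simp: subset_iff)
  also have "\<dots> = lin_ext u a \<oplus>\<^bsub>RG\<^esub> lin_ext u b"
    using assms F lin_ext_superset[of a ?F] lin_ext_superset[of b ?F] by simp
  finally show ?thesis .
qed

lemma lin_ext_monomial:
  assumes "r \<in> carrier R" "g \<in> carrier G"
  shows "lin_ext u (monomial r g) = scalar R r (u g)"
  using assms lin_ext_superset[of "monomial r g" "{g}"] supp_monomial[of r g]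
  by (simp add: monomial_apply u)

lemma lin_ext_scalar:
  assumes "a \<in> carrier RG" "r \<in> carrier R"
  shows "lin_ext u (scalar R r a) = scalar R r (lin_ext u a)"
  using assms
  by (induction a rule: group_ring_induct)
    (simp_all add: scalar_monomial lin_ext_monomial scalar_scalar scalar_add lin_ext_add lin_ext_closed u)

text \<open>By additivity only monomials \<open>r g\<close> and \<open>s h\<close> matter. There the
  scalar \<open>s\<close> has to move past \<open>u g\<close>, which is possible exactly because the
  coefficients of \<open>u g\<close> are central.\<close>

lemma lin_ext_mult:
  assumes "\<And>g h. \<lbrakk>g \<in> carrier G; h \<in> carrier G\<rbrakk> \<Longrightarrow> u (g \<otimes>\<^bsub>G\<^esub> h) = u g \<otimes>\<^bsub>RG\<^esub> u h"
    and "\<And>g k. g \<in> carrier G \<Longrightarrow> u g k \<in> center R"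
    and "a \<in> carrier RG" "b \<in> carrier RG"
  shows "lin_ext u (a \<otimes>\<^bsub>RG\<^esub> b) = lin_ext u a \<otimes>\<^bsub>RG\<^esub> lin_ext u b"
  using assms(3,4)
proof (induction a arbitrary: b rule: group_ring_induct)
  case (monomial r g)
  from monomial(3,1,2) show ?case
  proof (induction b rule: group_ring_induct)
    case (monomial s h)
    have comm: "monomial s \<one>\<^bsub>G\<^esub> \<otimes>\<^bsub>RG\<^esub> u g = u g \<otimes>\<^bsub>RG\<^esub> monomial s \<one>\<^bsub>G\<^esub>"
      using assms(2) coeff_center_iff[of "u g"] monomial u by blast
    have "lin_ext u (monomial r g \<otimes>\<^bsub>RG\<^esub> monomial s h)
        = (monomial r \<one>\<^bsub>G\<^esub> \<otimes>\<^bsub>RG\<^esub> monomial s \<one>\<^bsub>G\<^esub>) \<otimes>\<^bsub>RG\<^esub> (u g \<otimes>\<^bsub>RG\<^esub> u h)"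
      using monomial u by (simp add: monomial_mult lin_ext_monomial assms(1) scalar_eq_mult)
    also have "\<dots> = monomial r \<one>\<^bsub>G\<^esub> \<otimes>\<^bsub>RG\<^esub> ((monomial s \<one>\<^bsub>G\<^esub> \<otimes>\<^bsub>RG\<^esub> u g) \<otimes>\<^bsub>RG\<^esub> u h)"
      using monomial u by (simp add: RG.m_assoc)
    also have "\<dots> = lin_ext u (monomial r g) \<otimes>\<^bsub>RG\<^esub> lin_ext u (monomial s h)"
      unfolding comm using monomial u by (simp add: RG.m_assoc lin_ext_monomial scalar_eq_mult)
    finally show ?case .
  next
    case (add a b)
    then show ?case by (simp add: lin_ext_add lin_ext_closed RG.r_distr)
  qed
next
  case (add a b)
  then show ?case by (simp add: lin_ext_add lin_ext_closed RG.l_distr)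
qed

lemma lin_ext_endo:
  assumes "\<And>g h. \<lbrakk>g \<in> carrier G; h \<in> carrier G\<rbrakk> \<Longrightarrow> u (g \<otimes>\<^bsub>G\<^esub> h) = u g \<otimes>\<^bsub>RG\<^esub> u h"
    and "u \<one>\<^bsub>G\<^esub> = \<one>\<^bsub>RG\<^esub>"
    and "\<And>g k. g \<in> carrier G \<Longrightarrow> u g k \<in> center R"
  shows "linear_ring_endo R G (lin_ext u)"
  unfolding linear_ring_endo_def left_linear_def
proof (intro conjI ring_hom_memI ballI funcsetI)
  show "lin_ext u \<one>\<^bsub>RG\<^esub> = \<one>\<^bsub>RG\<^esub>"
    unfolding one_eq using lin_ext_monomial[of "\<one>\<^bsub>R\<^esub>" "\<one>\<^bsub>G\<^esub>"] u[of "\<one>\<^bsub>G\<^esub>"] assms(2)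
    by (simp add: scalar_one one_eq)
qed (use assms in \<open>auto simp: lin_ext_closed lin_ext_add lin_ext_scalar lin_ext_mult\<close>)

end

section \<open>Linear endomorphisms on scalars and on group elements\<close>

lemma left_linearD:
  assumes "left_linear R G \<phi>"
  shows "a \<in> carrier RG \<Longrightarrow> \<phi> a \<in> carrier RG"
    and "a \<in> carrier RG \<Longrightarrow> b \<in> carrier RG \<Longrightarrow> \<phi> (a \<oplus>\<^bsub>RG\<^esub> b) = \<phi> a \<oplus>\<^bsub>RG\<^esub> \<phi> b"
    and "r \<in> carrier R \<Longrightarrow> a \<in> carrier RG \<Longrightarrow>
      \<phi> (monomial r \<one>\<^bsub>G\<^esub> \<otimes>\<^bsub>RG\<^esub> a) = monomial r \<one>\<^bsub>G\<^esub> \<otimes>\<^bsub>RG\<^esub> \<phi> a"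
proof -
  show closed: "a \<in> carrier RG \<Longrightarrow> \<phi> a \<in> carrier RG" for a
    using assms unfolding left_linear_def by blast
  show "a \<in> carrier RG \<Longrightarrow> b \<in> carrier RG \<Longrightarrow> \<phi> (a \<oplus>\<^bsub>RG\<^esub> b) = \<phi> a \<oplus>\<^bsub>RG\<^esub> \<phi> b"
    using assms unfolding left_linear_def by blast
  show "r \<in> carrier R \<Longrightarrow> a \<in> carrier RG \<Longrightarrow>
      \<phi> (monomial r \<one>\<^bsub>G\<^esub> \<otimes>\<^bsub>RG\<^esub> a) = monomial r \<one>\<^bsub>G\<^esub> \<otimes>\<^bsub>RG\<^esub> \<phi> a"
    using assms closed unfolding left_linear_def by (metis scalar_eq_mult)
qed

lemma linear_ring_endoD:
  assumes "linear_ring_endo R G \<phi>"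
  shows "left_linear R G \<phi>" "\<phi> \<one>\<^bsub>RG\<^esub> = \<one>\<^bsub>RG\<^esub>"
    and "a \<in> carrier RG \<Longrightarrow> b \<in> carrier RG \<Longrightarrow> \<phi> (a \<otimes>\<^bsub>RG\<^esub> b) = \<phi> a \<otimes>\<^bsub>RG\<^esub> \<phi> b"
  using assms unfolding linear_ring_endo_def by (auto simp: ring_hom_def)

lemma group_elem_closed [simp]: "g \<in> carrier G \<Longrightarrow> group_elem R g \<in> carrier RG"
  by (simp add: group_elem_eq)

lemma group_elem_one: "group_elem R \<one>\<^bsub>G\<^esub> = \<one>\<^bsub>RG\<^esub>"
  by (simp add: group_elem_eq one_eq)

lemma group_elem_mult:
  "g \<in> carrier G \<Longrightarrow> h \<in> carrier G \<Longrightarrow>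
    group_elem R (g \<otimes>\<^bsub>G\<^esub> h) = group_elem R g \<otimes>\<^bsub>RG\<^esub> group_elem R h"
  by (simp add: group_elem_eq monomial_mult)

lemma monomial_group_elem_commute:
  "r \<in> carrier R \<Longrightarrow> g \<in> carrier G \<Longrightarrow>
    monomial r \<one>\<^bsub>G\<^esub> \<otimes>\<^bsub>RG\<^esub> group_elem R g = group_elem R g \<otimes>\<^bsub>RG\<^esub> monomial r \<one>\<^bsub>G\<^esub>"
  by (simp add: group_elem_eq monomial_mult)

text \<open>Linearity and unitality give \<phi>(r 1) = r \<phi>(1) = r.\<close>

lemma linear_ring_endo_constant:
  assumes "linear_ring_endo R G \<phi>" "r \<in> carrier R"
  shows "\<phi> (monomial r \<one>\<^bsub>G\<^esub>) = monomial r \<one>\<^bsub>G\<^esub>"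
  using left_linearD(3)[OF linear_ring_endoD(1)[OF assms(1)] assms(2) RG.one_closed] assms(2)
  by (simp add: linear_ring_endoD(2)[OF assms(1)])

text \<open>Apply \<phi> to \<open>r g = g r\<close>, using linearity on one side, and
  multiplicativity with fixed scalars on the other. Together with \<open>coeff_center_iff\<close>
  this says that \<phi>(g) has coefficients in the center of \<open>R\<close>.\<close>

lemma linear_ring_endo_commute:
  assumes \<phi>: "linear_ring_endo R G \<phi>" and r: "r \<in> carrier R" and g: "g \<in> carrier G"
  shows "monomial r \<one>\<^bsub>G\<^esub> \<otimes>\<^bsub>RG\<^esub> \<phi> (group_elem R g) = \<phi> (group_elem R g) \<otimes>\<^bsub>RG\<^esub> monomial r \<one>\<^bsub>G\<^esub>"
proof -
  have "monomial r \<one>\<^bsub>G\<^esub> \<otimes>\<^bsub>RG\<^esub> \<phi> (group_elem R g) = \<phi> (monomial r \<one>\<^bsub>G\<^esub> \<otimes>\<^bsub>RG\<^esub> group_elem R g)"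
    using left_linearD(3)[OF linear_ring_endoD(1)[OF \<phi>] r] g by simp
  also have "\<dots> = \<phi> (group_elem R g \<otimes>\<^bsub>RG\<^esub> monomial r \<one>\<^bsub>G\<^esub>)"
    using r g by (simp only: monomial_group_elem_commute)
  also have "\<dots> = \<phi> (group_elem R g) \<otimes>\<^bsub>RG\<^esub> monomial r \<one>\<^bsub>G\<^esub>"
    using linear_ring_endoD(3)[OF \<phi>] linear_ring_endo_constant[OF \<phi>] r g by simp
  finally show ?thesis .
qed

end

section \<open>Change of coefficients from the base ring to an overring\<close>

lemma coefficient_map_hom:
  assumes "group_algebra R G" "ring T" and \<iota>: "\<iota> \<in> ring_hom R T"
  shows "(\<lambda>f. \<iota> \<circ> f) \<in> ring_hom (group_ring R G) (group_ring T G)"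
proof -
  interpret A: group_algebra R G by fact
  interpret T: ring T by fact
  interpret B: group_algebra T G ..
  interpret \<iota>: ring_hom_ring R T \<iota>
    by (rule ring_hom_ringI2[OF A.R.ring_axioms T.ring_axioms \<iota>])
  have closed: "\<iota> \<circ> f \<in> carrier B.RG" if "f \<in> carrier A.RG" for f
    using that by (intro B.in_carrierI[of _ "A.supp f"]) (auto simp: A.coeff_outside A.supp_subset[THEN subsetD])
  have mon: "\<iota> \<circ> A.monomial r g = B.monomial (\<iota> r) g" for r g
    by (auto simp: A.monomial_apply B.monomial_apply)
  have hom_add: "\<iota> \<circ> (a \<oplus>\<^bsub>A.RG\<^esub> b) = (\<iota> \<circ> a) \<oplus>\<^bsub>B.RG\<^esub> (\<iota> \<circ> b)"
    if "a \<in> carrier A.RG" "b \<in> carrier A.RG" for a b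
    using that by (auto simp: A.add_apply B.add_apply)
  \<comment> \<open>Both sides are additive in each argument, so the check reduces to monomials,
    where it is multiplicativity of \<iota>.\<close>
  have mult: "\<iota> \<circ> (a \<otimes>\<^bsub>A.RG\<^esub> b) = (\<iota> \<circ> a) \<otimes>\<^bsub>B.RG\<^esub> (\<iota> \<circ> b)"
    if "a \<in> carrier A.RG" "b \<in> carrier A.RG" for a b
    using that
  proof (induction a arbitrary: b rule: A.group_ring_induct)
    case (monomial r g)
    from monomial(3,1,2) show ?case
      by (induction b rule: A.group_ring_induct)
        (simp_all add: A.monomial_mult B.monomial_mult mon hom_add A.RG.r_distr B.RG.r_distr closed)
  next
    case (add a a')
    then show ?case by (simp only: hom_add A.RG.l_distr B.RG.l_distr closed A.RG.m_closed)
  qed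
  show ?thesis
    by (rule ring_hom_memI) (auto simp: closed hom_add mult A.one_eq B.one_eq mon)
qed

text \<open>The extension is \<open>lin_ext\<close> of g \<mapsto> \<iota> \<circ> \<sigma>(g). This
  is multiplicative on \<open>G\<close> because \<sigma> and the coefficient map are ring
  homomorphisms, and its coefficients are images of central elements of \<open>R\<close>, hence
  central in \<open>T\<close>; so \<open>lin_ext_endo\<close> applies.\<close>

lemma extend_linear_endo:
  assumes "group_algebra R G" "ring T" and \<iota>: "\<iota> \<in> ring_hom R T" "\<iota> ` center R \<subseteq> center T"
    and \<sigma>: "linear_ring_endo R G \<sigma>"
  shows "linear_ring_endo T G (extend_linear R T \<iota> G \<sigma>)"
    and "g \<in> carrier G \<Longrightarrow>
      extend_linear R T \<iota> G \<sigma> (group_elem T g) = \<iota> \<circ> \<sigma> (group_elem R g)"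
proof -
  interpret A: group_algebra R G by fact
  interpret T: ring T by fact
  interpret B: group_algebra T G ..
  note hom = coefficient_map_hom[OF assms(1-3)]
  define u where "u = (\<lambda>g. \<iota> \<circ> \<sigma> (group_elem R g))"
  have eq: "extend_linear R T \<iota> G \<sigma> = B.lin_ext u"
    by (auto simp: extend_linear_def B.lin_ext_def B.supp_def u_def)
  have \<sigma>_closed: "\<sigma> (group_elem R g) \<in> carrier A.RG" if "g \<in> carrier G" for g
    using that A.left_linearD(1)[OF A.linear_ring_endoD(1)[OF \<sigma>]] by simp
  have u: "u g \<in> carrier B.RG" if "g \<in> carrier G" for g
    unfolding u_def using ring_hom_closed[OF hom] \<sigma>_closed[OF that] by blast
  show "linear_ring_endo T G (extend_linear R T \<iota> G \<sigma>)"
    unfolding eq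
  proof (rule B.lin_ext_endo[OF u])
    fix g h assume "g \<in> carrier G" "h \<in> carrier G"
    then show "u (g \<otimes>\<^bsub>G\<^esub> h) = u g \<otimes>\<^bsub>B.RG\<^esub> u h"
      unfolding u_def using ring_hom_mult[OF hom] \<sigma>_closed A.linear_ring_endoD(3)[OF \<sigma>]
      by (simp add: A.group_elem_mult)
  next
    show "u \<one>\<^bsub>G\<^esub> = \<one>\<^bsub>B.RG\<^esub>"
      unfolding u_def using ring_hom_one[OF hom] A.linear_ring_endoD(2)[OF \<sigma>]
      by (simp add: A.group_elem_one)
  next
    fix g k assume g: "g \<in> carrier G"
    then have "\<sigma> (group_elem R g) k \<in> center R"
      using A.coeff_center_iff[OF \<sigma>_closed[OF g]] A.linear_ring_endo_commute[OF \<sigma>] by blast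
    then show "u g k \<in> center T" using \<iota>(2) by (auto simp: u_def)
  qed
  show "extend_linear R T \<iota> G \<sigma> (group_elem T g) = \<iota> \<circ> \<sigma> (group_elem R g)" if "g \<in> carrier G"
    unfolding eq B.group_elem_eq using B.lin_ext_monomial[OF u, where r="\<one>\<^bsub>T\<^esub>" and g=g] that u[OF that]
    by (simp add: B.scalar_one u_def)
qed

section \<open>Skew derivations of the group ring\<close>

lemma center_closed: "z \<in> center M \<Longrightarrow> z \<in> carrier M"
  and center_commute: "z \<in> center M \<Longrightarrow> x \<in> carrier M \<Longrightarrow> z \<otimes>\<^bsub>M\<^esub> x = x \<otimes>\<^bsub>M\<^esub> z"
  and centerI: "z \<in> carrier M \<Longrightarrow> (\<And>x. x \<in> carrier M \<Longrightarrow> z \<otimes>\<^bsub>M\<^esub> x = x \<otimes>\<^bsub>M\<^esub> z) \<Longrightarrow> z \<in> center M"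
  unfolding center_def by blast+

lemma (in group) center_subgroup: "subgroup (center G) G"
proof (rule subgroupI)
  fix a assume a: "a \<in> center G"
  show "inv a \<in> center G"
  proof (rule centerI)
    fix x assume x: "x \<in> carrier G"
    note aG = center_closed[OF a] and comm = center_commute[OF a x]
    have "inv a \<otimes> x = inv a \<otimes> (x \<otimes> a) \<otimes> inv a" using aG x by (simp add: m_assoc)
    also have "\<dots> = x \<otimes> inv a" unfolding comm[symmetric] using aG x by (simp flip: m_assoc)
    finally show "inv a \<otimes> x = x \<otimes> inv a" .
  qed (use center_closed[OF a] in simp)
next
  fix a b assume a: "a \<in> center G" and b: "b \<in> center G"
  note closed = center_closed[OF a] center_closed[OF b]
  show "a \<otimes> b \<in> center G"
  proof (rule centerI)
    fix x assume x: "x \<in> carrier G"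
    have "a \<otimes> b \<otimes> x = a \<otimes> x \<otimes> b" using closed x by (simp add: m_assoc center_commute[OF b x])
    also have "\<dots> = x \<otimes> (a \<otimes> b)" unfolding center_commute[OF a x] using closed x by (simp add: m_assoc)
    finally show "a \<otimes> b \<otimes> x = x \<otimes> (a \<otimes> b)" .
  qed (use closed in simp)
next
  show "center G \<subseteq> carrier G" by (blast intro: center_closed)
  have "\<one> \<in> center G" by (rule centerI) simp_all
  then show "center G \<noteq> {}" by blast
qed

lemma (in group) center_normal: "center G \<lhd> G"
proof (rule normal_invI[OF center_subgroup])
  fix x h assume x: "x \<in> carrier G" and h: "h \<in> center G"
  then have "x \<otimes> h \<otimes> inv x = h" 
    using center_commute[OF h x] inv_solve_right[of h "x \<otimes> h" x] center_closed[OF h] by simp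
  with h show "x \<otimes> h \<otimes> inv x \<in> center G" by simp
qed

context group_algebra
begin

lemma nmult_apply:
  assumes "f \<in> carrier RG"
  shows "([(n::nat)] \<cdot>\<^bsub>RG\<^esub> f) g = [n] \<cdot>\<^bsub>R\<^esub> f g"
  by (induction n) (simp_all add: zero_apply add_apply)

lemma monomial_nmult:
  assumes "r \<in> carrier R" "g \<in> carrier G"
  shows "[(n::nat)] \<cdot>\<^bsub>RG\<^esub> monomial r g = monomial ([n] \<cdot>\<^bsub>R\<^esub> r) g"
  using assms by (intro ext) (simp add: nmult_apply monomial_apply)

lemma group_elem_central:
  assumes z: "z \<in> center G" and a: "a \<in> carrier RG"
  shows "group_elem R z \<otimes>\<^bsub>RG\<^esub> a = a \<otimes>\<^bsub>RG\<^esub> group_elem R z"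
  using a
proof (induction a rule: group_ring_induct)
  case (monomial r g)
  then show ?case
    using center_closed[OF z] center_commute[OF z] by (simp add: group_elem_eq monomial_mult)
next
  case (add a b)
  moreover have "z \<in> carrier G" using z by (rule center_closed)
  ultimately show ?case by (simp add: RG.r_distr RG.l_distr)
qed

text \<open>Makes the hypothesis that \<sigma> and \<tau> fix the center of the group ring
  applicable to central group elements.\<close>

lemma group_elem_in_center: "z \<in> center G \<Longrightarrow> group_elem R z \<in> center RG"
  by (intro centerI) (simp_all add: center_closed group_elem_central)

end

text \<open>To be instantiated with the localization as coefficient ring. Fixing is required on
  central group elements, a property that the extensions inherit through their values on group
  elements.\<close>

locale group_ring_derivation = group_algebra +
  fixes \<sigma> \<tau> \<delta> :: "('c \<Rightarrow> 'a) \<Rightarrow> 'c \<Rightarrow> 'a"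
  assumes \<sigma>: "linear_ring_endo R G \<sigma>"
    and \<tau>: "linear_ring_endo R G \<tau>"
    and \<delta>: "skew_derivation R G \<sigma> \<tau> \<delta>"
    and \<sigma>_fix: "\<And>z. z \<in> center G \<Longrightarrow> \<sigma> (group_elem R z) = group_elem R z"
    and \<tau>_fix: "\<And>z. z \<in> center G \<Longrightarrow> \<tau> (group_elem R z) = group_elem R z"
begin

section \<open>Skew derivations on scalars and on central group elements\<close>

lemma \<delta>_linear: "left_linear R G \<delta>"
  and leibniz: "a \<in> carrier RG \<Longrightarrow> b \<in> carrier RG \<Longrightarrow>
    \<delta> (a \<otimes>\<^bsub>RG\<^esub> b) = \<delta> a \<otimes>\<^bsub>RG\<^esub> \<tau> b \<oplus>\<^bsub>RG\<^esub> \<sigma> a \<otimes>\<^bsub>RG\<^esub> \<delta> b"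
  using \<delta> unfolding skew_derivation_def by blast+

lemmas \<sigma>D = linear_ring_endoD[OF \<sigma>]
lemmas \<tau>D = linear_ring_endoD[OF \<tau>]
lemmas \<delta>D = left_linearD[OF \<delta>_linear]

lemma closed [simp]:
  assumes "a \<in> carrier RG"
  shows "\<sigma> a \<in> carrier RG" "\<tau> a \<in> carrier RG" "\<delta> a \<in> carrier RG"
  using assms left_linearD(1)[OF \<sigma>D(1)] left_linearD(1)[OF \<tau>D(1)] \<delta>D(1) by blast+

text \<open>The Leibniz rule for 1 = 1 1, with \<sigma> and \<tau> unital, gives d = d + d.\<close>

lemma \<delta>_one: "\<delta> \<one>\<^bsub>RG\<^esub> = \<zero>\<^bsub>RG\<^esub>"
proof -
  have "\<delta> \<one>\<^bsub>RG\<^esub> = \<delta> \<one>\<^bsub>RG\<^esub> \<oplus>\<^bsub>RG\<^esub> \<delta> \<one>\<^bsub>RG\<^esub>"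
    using leibniz[of "\<one>\<^bsub>RG\<^esub>" "\<one>\<^bsub>RG\<^esub>"] by (simp add: \<sigma>D(2) \<tau>D(2))
  then show ?thesis by (metis RG.add.l_cancel_one RG.one_closed closed(3))
qed

text \<open>By linearity and \<open>\<delta>_one\<close>, \<delta> kills scalars; hence applying it
  to \<open>r g = g r\<close> leaves a single Leibniz term on the right.\<close>

lemma \<delta>_commute:
  assumes r: "r \<in> carrier R" and g: "g \<in> carrier G"
  shows "monomial r \<one>\<^bsub>G\<^esub> \<otimes>\<^bsub>RG\<^esub> \<delta> (group_elem R g) = \<delta> (group_elem R g) \<otimes>\<^bsub>RG\<^esub> monomial r \<one>\<^bsub>G\<^esub>"
proof -
  have 0: "\<delta> (monomial r \<one>\<^bsub>G\<^esub>) = \<zero>\<^bsub>RG\<^esub>"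
    using \<delta>D(3)[OF r RG.one_closed] r by (simp add: \<delta>_one)
  have "monomial r \<one>\<^bsub>G\<^esub> \<otimes>\<^bsub>RG\<^esub> \<delta> (group_elem R g) = \<delta> (monomial r \<one>\<^bsub>G\<^esub> \<otimes>\<^bsub>RG\<^esub> group_elem R g)"
    using \<delta>D(3)[OF r] g by simp
  also have "\<dots> = \<delta> (group_elem R g \<otimes>\<^bsub>RG\<^esub> monomial r \<one>\<^bsub>G\<^esub>)"
    using r g by (simp only: monomial_group_elem_commute)
  also have "\<dots> = \<delta> (group_elem R g) \<otimes>\<^bsub>RG\<^esub> monomial r \<one>\<^bsub>G\<^esub>"
    using r g by (simp add: leibniz linear_ring_endo_constant[OF \<tau>] 0)
  finally show ?thesis .
qed

text \<open>The usual power rule: \<sigma> and \<tau> fix the powers of \<open>z\<close>, and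
  \<open>z\<close> commutes with \<delta>(z), so all Leibniz terms coincide. The exponent
  \<open>Suc n\<close> avoids a truncated predecessor.\<close>

lemma \<delta>_power:
  assumes z: "z \<in> center G"
  shows "\<delta> (group_elem R (z [^]\<^bsub>G\<^esub> Suc n)) =
    [(Suc n)] \<cdot>\<^bsub>RG\<^esub> (group_elem R (z [^]\<^bsub>G\<^esub> n) \<otimes>\<^bsub>RG\<^esub> \<delta> (group_elem R z))"
proof (induction n)
  have zG: "z \<in> carrier G" using z by (rule center_closed)
  case 0
  show ?case using zG by (simp add: group_elem_one)
next
  case (Suc n)
  have zG: "z \<in> carrier G" using z by (rule center_closed)
  let ?d = "\<delta> (group_elem R z)"
  let ?e = "\<lambda>n::nat. group_elem R (z [^]\<^bsub>G\<^esub> n)"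
  have pow: "z [^]\<^bsub>G\<^esub> k \<in> center G" for k :: nat
    using center_subgroup z by (induction k) (auto simp: subgroup.one_closed subgroup.m_closed)
  have [simp]: "?e k \<in> carrier RG" for k using zG by simp
  have e: "?e (Suc k) = ?e k \<otimes>\<^bsub>RG\<^esub> group_elem R z" for k
    using zG by (simp add: group_elem_mult)
  have "\<delta> (?e (Suc (Suc n))) = \<delta> (?e (Suc n)) \<otimes>\<^bsub>RG\<^esub> group_elem R z \<oplus>\<^bsub>RG\<^esub> ?e (Suc n) \<otimes>\<^bsub>RG\<^esub> ?d"
    unfolding e[of "Suc n"] using zG z pow[of "Suc n"] \<sigma>_fix[OF pow[of "Suc n"]]
    by (subst leibniz) (simp_all add: \<tau>_fix del: nat_pow_Suc)
  also have "\<delta> (?e (Suc n)) \<otimes>\<^bsub>RG\<^esub> group_elem R z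
      = [(Suc n)] \<cdot>\<^bsub>RG\<^esub> (?e n \<otimes>\<^bsub>RG\<^esub> (?d \<otimes>\<^bsub>RG\<^esub> group_elem R z))"
    unfolding Suc.IH using zG by (subst RG.add_pow_ldistr) (simp_all add: RG.m_assoc del: RG.add.nat_pow_Suc)
  also have "?d \<otimes>\<^bsub>RG\<^esub> group_elem R z = group_elem R z \<otimes>\<^bsub>RG\<^esub> ?d"
    using group_elem_central[OF z, of ?d] zG by simp
  also have "?e n \<otimes>\<^bsub>RG\<^esub> (group_elem R z \<otimes>\<^bsub>RG\<^esub> ?d) = ?e (Suc n) \<otimes>\<^bsub>RG\<^esub> ?d"
    unfolding e using zG by (simp add: RG.m_assoc)
  finally show ?case by (simp only: RG.add.nat_pow_Suc)
qed

lemma \<delta>_central: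
  fixes n :: nat
  assumes z: "z \<in> center G" and n: "n > 0" "z [^]\<^bsub>G\<^esub> n = \<one>\<^bsub>G\<^esub>"
    and torsion_free: "\<And>r. r \<in> carrier R \<Longrightarrow> [n] \<cdot>\<^bsub>R\<^esub> r = \<zero>\<^bsub>R\<^esub> \<Longrightarrow> r = \<zero>\<^bsub>R\<^esub>"
  shows "\<delta> (group_elem R z) = \<zero>\<^bsub>RG\<^esub>"
proof -
  have zG: "z \<in> carrier G" using z by (rule center_closed)
  obtain m where m: "n = Suc m" using n by (metis gr0_implies_Suc)
  let ?d = "\<delta> (group_elem R z)" and ?e = "group_elem R (z [^]\<^bsub>G\<^esub> m)"
  have "[n] \<cdot>\<^bsub>RG\<^esub> (?e \<otimes>\<^bsub>RG\<^esub> ?d) = \<delta> (group_elem R (z [^]\<^bsub>G\<^esub> n))"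
    unfolding m \<delta>_power[OF z] ..
  also have "\<dots> = \<zero>\<^bsub>RG\<^esub>" unfolding n(2) group_elem_one by (rule \<delta>_one)
  finally have eq: "[n] \<cdot>\<^bsub>RG\<^esub> (?e \<otimes>\<^bsub>RG\<^esub> ?d) = \<zero>\<^bsub>RG\<^esub>" .
  have ed: "?e \<otimes>\<^bsub>RG\<^esub> ?d \<in> carrier RG" using zG by simp
  \<comment> \<open>The cancellation of \<open>n\<close> is assumed in the coefficient ring, so it
    is carried out at each coefficient.\<close>
  have "(?e \<otimes>\<^bsub>RG\<^esub> ?d) g = \<zero>\<^bsub>R\<^esub>" for g
    using fun_cong[OF eq, of g] ed torsion_free[of "(?e \<otimes>\<^bsub>RG\<^esub> ?d) g"]
    by (simp add: nmult_apply zero_apply)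
  then have 0: "?e \<otimes>\<^bsub>RG\<^esub> ?d = \<zero>\<^bsub>RG\<^esub>" by (auto simp: zero_apply)
  \<comment> \<open>The factor \<open>?e\<close> is a unit with inverse \<open>z\<close>, since
    multiplying it by \<open>z\<close> gives \<open>z\<close> to the power \<open>n\<close>.\<close>
  have "group_elem R z \<otimes>\<^bsub>RG\<^esub> ?e = \<one>\<^bsub>RG\<^esub>"
    using zG n(2) unfolding m by (simp add: group_elem_one group_elem_mult[symmetric] G.nat_pow_Suc2[symmetric] del: G.nat_pow_Suc)
  then have "?d = group_elem R z \<otimes>\<^bsub>RG\<^esub> (?e \<otimes>\<^bsub>RG\<^esub> ?d)"
    using zG by (simp add: RG.m_assoc[symmetric])
  also have "\<dots> = \<zero>\<^bsub>RG\<^esub>" unfolding 0 using zG by simp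
  finally show ?thesis .
qed

text \<open>The group 1-cocycle attached to \<delta>, where \<open>g\<close> acts on the group ring
  by a \<mapsto> \<sigma>(g) a \<tau>(g)^-1. Inner derivations correspond to coboundaries x -
  \<sigma>(g) x \<tau>(g)^-1, so \<open>x\<close> is to be found by averaging.\<close>

definition cocycle :: "'c \<Rightarrow> 'c \<Rightarrow> 'a" where
  "cocycle g = \<delta> (group_elem R g) \<otimes>\<^bsub>RG\<^esub> \<tau> (group_elem R (inv\<^bsub>G\<^esub> g))"

lemma cocycle_closed [simp]: "g \<in> carrier G \<Longrightarrow> cocycle g \<in> carrier RG"
  by (simp add: cocycle_def)

lemma cocycle_commute:
  assumes "r \<in> carrier R" "g \<in> carrier G"
  shows "monomial r \<one>\<^bsub>G\<^esub> \<otimes>\<^bsub>RG\<^esub> cocycle g = cocycle g \<otimes>\<^bsub>RG\<^esub> monomial r \<one>\<^bsub>G\<^esub>"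
proof -
  have "monomial r \<one>\<^bsub>G\<^esub> \<otimes>\<^bsub>RG\<^esub> cocycle g =
      \<delta> (group_elem R g) \<otimes>\<^bsub>RG\<^esub> (monomial r \<one>\<^bsub>G\<^esub> \<otimes>\<^bsub>RG\<^esub> \<tau> (group_elem R (inv\<^bsub>G\<^esub> g)))"
    using assms by (simp add: cocycle_def \<delta>_commute flip: RG.m_assoc)
  also have "\<dots> = cocycle g \<otimes>\<^bsub>RG\<^esub> monomial r \<one>\<^bsub>G\<^esub>"
    using assms by (simp add: cocycle_def linear_ring_endo_commute[OF \<tau>] RG.m_assoc)
  finally show ?thesis .
qed

text \<open>The cocycle identity, multiplied on the right by \<tau>(h): this factor turns
  \<tau>((hg)^-1) into \<tau>(g^-1), and the Leibniz rule for \<open>hg\<close> does the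
  rest.\<close>

lemma cocycle_translate:
  assumes "g \<in> carrier G" "h \<in> carrier G"
  shows "cocycle (h \<otimes>\<^bsub>G\<^esub> g) \<otimes>\<^bsub>RG\<^esub> \<tau> (group_elem R h) =
    \<sigma> (group_elem R h) \<otimes>\<^bsub>RG\<^esub> cocycle g \<oplus>\<^bsub>RG\<^esub> \<delta> (group_elem R h)"
proof -
  have "group_elem R (inv\<^bsub>G\<^esub> (h \<otimes>\<^bsub>G\<^esub> g)) \<otimes>\<^bsub>RG\<^esub> group_elem R h = group_elem R (inv\<^bsub>G\<^esub> g)"
    using assms by (simp add: group_elem_mult[symmetric] G.inv_mult_group G.m_assoc)
  then have "cocycle (h \<otimes>\<^bsub>G\<^esub> g) \<otimes>\<^bsub>RG\<^esub> \<tau> (group_elem R h) =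
      \<delta> (group_elem R (h \<otimes>\<^bsub>G\<^esub> g)) \<otimes>\<^bsub>RG\<^esub> \<tau> (group_elem R (inv\<^bsub>G\<^esub> g))"
    using assms \<tau>D(3)[of "group_elem R (inv\<^bsub>G\<^esub> (h \<otimes>\<^bsub>G\<^esub> g))" "group_elem R h"]
    by (simp add: cocycle_def RG.m_assoc)
  also have "\<dots> = \<delta> (group_elem R h) \<otimes>\<^bsub>RG\<^esub> \<tau> (group_elem R g \<otimes>\<^bsub>RG\<^esub> group_elem R (inv\<^bsub>G\<^esub> g))
      \<oplus>\<^bsub>RG\<^esub> \<sigma> (group_elem R h) \<otimes>\<^bsub>RG\<^esub> cocycle g"
    using assms by (simp add: group_elem_mult leibniz cocycle_def RG.l_distr RG.m_assoc \<tau>D(3))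
  also have "\<tau> (group_elem R g \<otimes>\<^bsub>RG\<^esub> group_elem R (inv\<^bsub>G\<^esub> g)) = \<one>\<^bsub>RG\<^esub>"
    using assms by (simp add: group_elem_mult[symmetric] group_elem_one \<tau>D(2))
  finally show ?thesis using assms by (simp add: RG.a_comm)
qed

text \<open>When \<delta>(z) = 0 and \<sigma>, \<tau> fix \<open>z\<close>, the translation formula
  becomes c(zg) z = z c(g) = c(g) z, and the unit \<open>z\<close> cancels. Hence the cocycle is
  constant on cosets of the center.\<close>

lemma cocycle_central_translate:
  assumes g: "g \<in> carrier G" and z: "z \<in> center G" and 0: "\<delta> (group_elem R z) = \<zero>\<^bsub>RG\<^esub>"
  shows "cocycle (z \<otimes>\<^bsub>G\<^esub> g) = cocycle g"
proof -
  have zG: "z \<in> carrier G" using z by (rule center_closed)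
  have iz: "group_elem R z \<otimes>\<^bsub>RG\<^esub> group_elem R (inv\<^bsub>G\<^esub> z) = \<one>\<^bsub>RG\<^esub>"
    using zG by (simp add: group_elem_mult[symmetric] group_elem_one)
  have "cocycle (z \<otimes>\<^bsub>G\<^esub> g) \<otimes>\<^bsub>RG\<^esub> group_elem R z = cocycle g \<otimes>\<^bsub>RG\<^esub> group_elem R z"
    using cocycle_translate[OF g zG] z zG g group_elem_central[OF z, of "cocycle g"]
    by (simp add: \<sigma>_fix \<tau>_fix 0)
  then have "cocycle (z \<otimes>\<^bsub>G\<^esub> g) \<otimes>\<^bsub>RG\<^esub> (group_elem R z \<otimes>\<^bsub>RG\<^esub> group_elem R (inv\<^bsub>G\<^esub> z))
      = cocycle g \<otimes>\<^bsub>RG\<^esub> (group_elem R z \<otimes>\<^bsub>RG\<^esub> group_elem R (inv\<^bsub>G\<^esub> z))"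
    using zG g by (simp add: RG.m_assoc[symmetric])
  then show ?thesis using zG g by (simp add: iz)
qed

text \<open>Averaging in the style of Maschke, but over the finite quotient by the center, since
  \<open>G\<close> itself may be infinite. The element \<open>u\<close> is the inverse of the
  index.\<close>

lemma skew_inner_if_index_invertible:
  assumes fin: "finite (rcosets\<^bsub>G\<^esub> (center G))"
    and central: "\<And>z. z \<in> center G \<Longrightarrow> \<delta> (group_elem R z) = \<zero>\<^bsub>RG\<^esub>"
    and inv: "u \<in> center R" "[(card (rcosets\<^bsub>G\<^esub> (center G)))] \<cdot>\<^bsub>R\<^esub> u = \<one>\<^bsub>R\<^esub>"
  shows "skew_inner R G \<sigma> \<tau> \<delta>"
proof -
  let ?Z = "center G"
  let ?Q = "rcosets\<^bsub>G\<^esub> ?Z"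
  interpret N: normal ?Z G by (rule center_normal)
  interpret Q: group "G Mod ?Z" by (rule N.factorgroup_is_group)
  have Q: "carrier (G Mod ?Z) = ?Q" by (simp add: FactGroup_def)
  \<comment> \<open>The cocycle as a function on cosets, evaluated at an arbitrary
    representative.\<close>
  define W where "W C = cocycle (SOME g. g \<in> C)" for C
  have W: "W (?Z #>\<^bsub>G\<^esub> g) = cocycle g" if g: "g \<in> carrier G" for g
  proof -
    have "(SOME k. k \<in> ?Z #>\<^bsub>G\<^esub> g) \<in> ?Z #>\<^bsub>G\<^esub> g"
      using G.rcos_self[OF g N.is_subgroup] by (rule someI)
    then obtain z where "z \<in> ?Z" "(SOME k. k \<in> ?Z #>\<^bsub>G\<^esub> g) = z \<otimes>\<^bsub>G\<^esub> g"
      by (auto simp: r_coset_def)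
    then show ?thesis using cocycle_central_translate[OF g] central by (simp add: W_def)
  qed
  have Wclosed: "W \<in> ?Q \<rightarrow> carrier RG" by (auto simp: RCOSETS_def W)
  have WQ: "W C \<in> carrier RG" if "C \<in> ?Q" for C using Wclosed that by blast
  define y where "y = (\<Oplus>\<^bsub>RG\<^esub>C\<in>?Q. W C)"
  define U where "U = monomial u \<one>\<^bsub>G\<^esub>"
  \<comment> \<open>The average of the cocycle over the cosets, with \<open>U\<close> the scalar
    1/index.\<close>
  define x where "x = U \<otimes>\<^bsub>RG\<^esub> y"
  have u: "u \<in> carrier R" using inv(1) by (rule center_closed)
  have y: "y \<in> carrier RG" unfolding y_def by (rule RG.finsum_closed[OF Wclosed])
  have U: "U \<in> carrier RG" unfolding U_def using u by simp
  have x: "x \<in> carrier RG" unfolding x_def using U y by simp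
  have y_commute: "monomial r \<one>\<^bsub>G\<^esub> \<otimes>\<^bsub>RG\<^esub> y = y \<otimes>\<^bsub>RG\<^esub> monomial r \<one>\<^bsub>G\<^esub>" if r: "r \<in> carrier R" for r
  proof -
    have "monomial r \<one>\<^bsub>G\<^esub> \<otimes>\<^bsub>RG\<^esub> y = (\<Oplus>\<^bsub>RG\<^esub>C\<in>?Q. monomial r \<one>\<^bsub>G\<^esub> \<otimes>\<^bsub>RG\<^esub> W C)"
      unfolding y_def using fin r Wclosed by (intro RG.finsum_rdistr) auto
    also have "\<dots> = (\<Oplus>\<^bsub>RG\<^esub>C\<in>?Q. W C \<otimes>\<^bsub>RG\<^esub> monomial r \<one>\<^bsub>G\<^esub>)"
      using r Wclosed by (intro RG.finsum_cong') (auto simp: RCOSETS_def W cocycle_commute)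
    also have "\<dots> = y \<otimes>\<^bsub>RG\<^esub> monomial r \<one>\<^bsub>G\<^esub>"
      unfolding y_def using fin r Wclosed by (intro RG.finsum_ldistr[symmetric]) auto
    finally show ?thesis .
  qed
  \<comment> \<open>This is what later carries \<open>key\<close> from group elements to monomials:
    in x \<tau>(r g) the scalar \<open>r\<close> must be moved to the left of
    \<open>x\<close>.\<close>
  have x_commute: "monomial r \<one>\<^bsub>G\<^esub> \<otimes>\<^bsub>RG\<^esub> x = x \<otimes>\<^bsub>RG\<^esub> monomial r \<one>\<^bsub>G\<^esub>" if r: "r \<in> carrier R" for r
  proof -
    have "monomial r \<one>\<^bsub>G\<^esub> \<otimes>\<^bsub>RG\<^esub> U = U \<otimes>\<^bsub>RG\<^esub> monomial r \<one>\<^bsub>G\<^esub>"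
      unfolding U_def using r u by (simp add: monomial_mult center_commute[OF inv(1) r])
    then have "monomial r \<one>\<^bsub>G\<^esub> \<otimes>\<^bsub>RG\<^esub> x = U \<otimes>\<^bsub>RG\<^esub> (monomial r \<one>\<^bsub>G\<^esub> \<otimes>\<^bsub>RG\<^esub> y)"
      unfolding x_def using r U y by (simp add: RG.m_assoc[symmetric])
    then show ?thesis
      unfolding x_def y_commute[OF r] using r U y by (simp add: RG.m_assoc)
  qed
  have key: "x \<otimes>\<^bsub>RG\<^esub> \<tau> (group_elem R h) = \<sigma> (group_elem R h) \<otimes>\<^bsub>RG\<^esub> x \<oplus>\<^bsub>RG\<^esub> \<delta> (group_elem R h)"
    if h: "h \<in> carrier G" for h
  proof -
    let ?e = "group_elem R h" and ?m = "card ?Q"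
    let ?T = "\<lambda>C. (?Z #>\<^bsub>G\<^esub> h) <#>\<^bsub>G\<^esub> C"
    have hQ: "?Z #>\<^bsub>G\<^esub> h \<in> carrier (G Mod ?Z)" using h by (auto simp: Q RCOSETS_def)
    \<comment> \<open>Multiplication by the coset of \<open>h\<close> permutes the quotient group,
      so the sum \<open>y\<close> may be reindexed by it and \<open>cocycle_translate\<close>
      applied termwise.\<close>
    have surj: "?T ` ?Q = ?Q" using Q.surj_const_mult[OF hQ] by (simp add: Q)
    have inj: "inj_on ?T ?Q" using Q.inj_on_cmult[OF hQ] by (simp add: Q)
    have WT: "W (?T C) \<in> carrier RG" if "C \<in> ?Q" for C
      using Wclosed surj that by auto
    have "y = (\<Oplus>\<^bsub>RG\<^esub>C\<in>?Q. W (?T C))"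
      unfolding y_def using RG.finsum_reindex[of W ?T ?Q] Wclosed inj by (simp add: surj)
    then have "y \<otimes>\<^bsub>RG\<^esub> \<tau> ?e = (\<Oplus>\<^bsub>RG\<^esub>C\<in>?Q. W (?T C) \<otimes>\<^bsub>RG\<^esub> \<tau> ?e)"
      using fin h WT by (simp add: RG.finsum_ldistr)
    also have "\<dots> = (\<Oplus>\<^bsub>RG\<^esub>C\<in>?Q. \<sigma> ?e \<otimes>\<^bsub>RG\<^esub> W C \<oplus>\<^bsub>RG\<^esub> \<delta> ?e)"
    proof (intro RG.finsum_cong')
      fix C assume "C \<in> ?Q"
      then obtain g where g: "g \<in> carrier G" "C = ?Z #>\<^bsub>G\<^esub> g" by (auto simp: RCOSETS_def)
      then show "W (?T C) \<otimes>\<^bsub>RG\<^esub> \<tau> ?e = \<sigma> ?e \<otimes>\<^bsub>RG\<^esub> W C \<oplus>\<^bsub>RG\<^esub> \<delta> ?e"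
        using h by (simp add: N.rcos_sum W cocycle_translate)
    next
      show "(\<lambda>C. \<sigma> ?e \<otimes>\<^bsub>RG\<^esub> W C \<oplus>\<^bsub>RG\<^esub> \<delta> ?e) \<in> ?Q \<rightarrow> carrier RG"
        using WQ h by (intro funcsetI) simp
    qed simp
    also have "\<dots> = (\<Oplus>\<^bsub>RG\<^esub>C\<in>?Q. \<sigma> ?e \<otimes>\<^bsub>RG\<^esub> W C) \<oplus>\<^bsub>RG\<^esub> (\<Oplus>\<^bsub>RG\<^esub>C\<in>?Q. \<delta> ?e)"
      using Wclosed h by (intro RG.finsum_addf) auto
    also have "(\<Oplus>\<^bsub>RG\<^esub>C\<in>?Q. \<sigma> ?e \<otimes>\<^bsub>RG\<^esub> W C) = \<sigma> ?e \<otimes>\<^bsub>RG\<^esub> y"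
      unfolding y_def using fin h Wclosed by (intro RG.finsum_rdistr[symmetric]) auto
    also have "(\<Oplus>\<^bsub>RG\<^esub>C\<in>?Q. \<delta> ?e) = [?m] \<cdot>\<^bsub>RG\<^esub> \<delta> ?e"
      using h by (intro RG.add.finprod_const) auto
    finally have sum: "y \<otimes>\<^bsub>RG\<^esub> \<tau> ?e = \<sigma> ?e \<otimes>\<^bsub>RG\<^esub> y \<oplus>\<^bsub>RG\<^esub> [?m] \<cdot>\<^bsub>RG\<^esub> \<delta> ?e" .
    \<comment> \<open>The term \<delta>(h) occurs once per coset; multiplying by \<open>U\<close>
      turns the sum of these copies back into \<delta>(h).\<close>
    have "U \<otimes>\<^bsub>RG\<^esub> [?m] \<cdot>\<^bsub>RG\<^esub> \<delta> ?e = [?m] \<cdot>\<^bsub>RG\<^esub> U \<otimes>\<^bsub>RG\<^esub> \<delta> ?e"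
      using U h by (simp add: RG.add_pow_ldistr RG.add_pow_rdistr)
    also have "[?m] \<cdot>\<^bsub>RG\<^esub> U = \<one>\<^bsub>RG\<^esub>"
      unfolding U_def using u by (simp add: monomial_nmult inv(2) one_eq)
    finally have Um: "U \<otimes>\<^bsub>RG\<^esub> [?m] \<cdot>\<^bsub>RG\<^esub> \<delta> ?e = \<delta> ?e" using h by simp
    \<comment> \<open>The scalar moves past \<sigma>(h), whose coefficients are central.\<close>
    have "U \<otimes>\<^bsub>RG\<^esub> (\<sigma> ?e \<otimes>\<^bsub>RG\<^esub> y) = \<sigma> ?e \<otimes>\<^bsub>RG\<^esub> x"
      using linear_ring_endo_commute[OF \<sigma> u h] U h y unfolding x_def U_def
      by (simp add: RG.m_assoc[symmetric])
    then have "U \<otimes>\<^bsub>RG\<^esub> (y \<otimes>\<^bsub>RG\<^esub> \<tau> ?e) = \<sigma> ?e \<otimes>\<^bsub>RG\<^esub> x \<oplus>\<^bsub>RG\<^esub> \<delta> ?e"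
      unfolding sum using U h y Um by (simp add: RG.r_distr)
    then show ?thesis unfolding x_def using U y h by (simp add: RG.m_assoc)
  qed
  have eq: "x \<otimes>\<^bsub>RG\<^esub> \<tau> a = \<sigma> a \<otimes>\<^bsub>RG\<^esub> x \<oplus>\<^bsub>RG\<^esub> \<delta> a" if "a \<in> carrier RG" for a
    using that
  proof (induction a rule: group_ring_induct)
    case (monomial r g)
    let ?c = "monomial r \<one>\<^bsub>G\<^esub>" and ?e = "group_elem R g"
    have c: "?c \<in> carrier RG" and e: "?e \<in> carrier RG" using monomial by auto
    have mon: "monomial r g = ?c \<otimes>\<^bsub>RG\<^esub> ?e"
      using monomial by (simp add: group_elem_eq monomial_mult)
    have lin: "\<tau> (?c \<otimes>\<^bsub>RG\<^esub> ?e) = ?c \<otimes>\<^bsub>RG\<^esub> \<tau> ?e" "\<sigma> (?c \<otimes>\<^bsub>RG\<^esub> ?e) = ?c \<otimes>\<^bsub>RG\<^esub> \<sigma> ?e"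
        "\<delta> (?c \<otimes>\<^bsub>RG\<^esub> ?e) = ?c \<otimes>\<^bsub>RG\<^esub> \<delta> ?e"
      using monomial left_linearD(3)[OF \<tau>D(1)] left_linearD(3)[OF \<sigma>D(1)] \<delta>D(3) by simp_all
    have "x \<otimes>\<^bsub>RG\<^esub> (?c \<otimes>\<^bsub>RG\<^esub> \<tau> ?e) = ?c \<otimes>\<^bsub>RG\<^esub> (x \<otimes>\<^bsub>RG\<^esub> \<tau> ?e)"
      using x c e x_commute[OF monomial(1)] by (simp add: RG.m_assoc[symmetric])
    then show ?case
      unfolding mon lin key[OF monomial(2)] using x c e by (simp add: RG.m_assoc RG.r_distr)
  next
    case (add a b)
    have "\<sigma> (a \<oplus>\<^bsub>RG\<^esub> b) = \<sigma> a \<oplus>\<^bsub>RG\<^esub> \<sigma> b" "\<tau> (a \<oplus>\<^bsub>RG\<^esub> b) = \<tau> a \<oplus>\<^bsub>RG\<^esub> \<tau> b"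
        "\<delta> (a \<oplus>\<^bsub>RG\<^esub> b) = \<delta> a \<oplus>\<^bsub>RG\<^esub> \<delta> b"
      using add left_linearD(2)[OF \<tau>D(1)] left_linearD(2)[OF \<sigma>D(1)] \<delta>D(2) by simp_all
    with add x show ?case by (simp add: RG.r_distr RG.l_distr RG.a_ac)
  qed
  have "\<delta> a = x \<otimes>\<^bsub>RG\<^esub> \<tau> a \<ominus>\<^bsub>RG\<^esub> \<sigma> a \<otimes>\<^bsub>RG\<^esub> x" if "a \<in> carrier RG" for a
  proof -
    have "x \<otimes>\<^bsub>RG\<^esub> \<tau> a = \<delta> a \<oplus>\<^bsub>RG\<^esub> \<sigma> a \<otimes>\<^bsub>RG\<^esub> x"
      using eq[OF that] x that by (simp add: RG.a_comm)
    then show ?thesis using that x by (simp add: a_minus_def RG.a_assoc RG.r_neg)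
  qed
  then show ?thesis unfolding skew_inner_def using x by blast
qed

end

section \<open>The index of the center\<close>

text \<open>Sylow's existence theorem with exponent 1, where the cofactor \<open>m\<close> may still
  be divisible by \<open>p\<close>, gives a subgroup of order \<open>p\<close>. Any nontrivial
  element of it has order dividing \<open>p\<close> and different from 1.\<close>

lemma (in group) cauchy:
  assumes "finite (carrier G)" "Factorial_Ring.prime p" "p dvd order G"
  shows "\<exists>q\<in>carrier G. ord q = p"
proof -
  obtain m where m: "order G = p * m" using assms(3) by (rule dvdE)
  have "order G = p ^ 1 * m" using m by simp
  from sylow_thm[OF assms(2) is_group this assms(1)]
  obtain H where H: "subgroup H G" "card H = p" by (metis power_one_right)
  interpret H: group "G\<lparr>carrier := H\<rparr>" by (rule subgroup.subgroup_is_group[OF H(1) is_group])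
  have "\<not> H \<subseteq> {\<one>}"
  proof
    assume "H \<subseteq> {\<one>}"
    then have "card H \<le> 1" using card_mono[of "{\<one>}" H] by simp
    then show False using H(2) prime_gt_1_nat[OF assms(2)] by simp
  qed
  then obtain q where q: "q \<in> H" "q \<noteq> \<one>" by blast
  have "q [^]\<^bsub>G\<lparr>carrier := H\<rparr>\<^esub> p = \<one>"
    using H.pow_order_eq_1[of q] q(1) H(2) by (simp add: order_def)
  then have "q [^] p = \<one>" unfolding nat_pow_consistent[of q p H] .
  moreover have qG: "q \<in> carrier G" by (rule subgroup.mem_carrier[OF H(1) q(1)])
  ultimately have "ord q dvd p" using pow_eq_id[OF qG] by blast
  moreover have "ord q \<noteq> 1" using q(2) ord_eq_1[OF qG] by blast
  ultimately have "ord q = p" by (meson assms(2) prime_nat_iff)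
  with qG show ?thesis by (rule bexI[rotated])
qed

text \<open>Cauchy's theorem gives an element of order \<open>p\<close> in the quotient, and the
  order of a coset divides the order of each representative.\<close>

lemma (in group) prime_dvd_index:
  assumes "N \<lhd> G" "finite (rcosets N)" "Factorial_Ring.prime p" "p dvd card (rcosets N)"
  shows "\<exists>g\<in>carrier G. p dvd ord g"
proof -
  interpret N: normal N G by fact
  interpret Q: group "G Mod N" by (rule N.factorgroup_is_group)
  interpret h: group_hom G "G Mod N" "\<lambda>a. N #> a"
    by (simp add: group_hom_def group_hom_axioms_def N.r_coset_hom_Mod is_group Q.is_group)
  have "carrier (G Mod N) = rcosets N" by (simp add: FactGroup_def)
  then obtain q where "q \<in> carrier (G Mod N)" and q: "Q.ord q = p"
    using Q.cauchy[of p] assms by (auto simp: order_def)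
  then obtain g where g: "g \<in> carrier G" "q = N #> g" by (auto simp: carrier_FactGroup)
  \<comment> \<open>For \<open>g\<close> of infinite order \<open>ord g\<close> is 0, and the
    divisibility below still holds.\<close>
  have "q [^]\<^bsub>G Mod N\<^esub> ord g = \<one>\<^bsub>G Mod N\<^esub>"
    using h.hom_nat_pow[OF g(1), of "ord g"] g by simp
  then have "p dvd ord g" using Q.pow_eq_id[OF \<open>q \<in> carrier (G Mod N)\<close>] q by blast
  with g show ?thesis by blast
qed

text \<open>The denominators to be inverted. For a torsion group they include all element orders,
  needed for \<delta>(z) = 0, and, by \<open>prime_dvd_index\<close>, a finite index of the center,
  needed for averaging.\<close>

definition order_primes_monoid :: "('g, 'n) monoid_scheme \<Rightarrow> nat set" where
  "order_primes_monoid G =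
    {n. n > 0 \<and> (\<forall>p. Factorial_Ring.prime p \<longrightarrow> p dvd n \<longrightarrow> (\<exists>g\<in>carrier G. p dvd group.ord G g))}"

text \<open>Prime factors are stripped one at a time: if p k r = 0 with k r nonzero, then k r is a
  \<open>p\<close>-torsion element while \<open>p\<close> divides the order of a group element,
  which both alternatives exclude. Closure under products holds since a prime dividing a product
  divides a factor.\<close>

lemma order_primes_localization:
  assumes "ring R" "group G"
    and "torsion_free_ring R \<or>
         (\<forall>p::nat. Factorial_Ring.prime p \<longrightarrow> has_p_torsion p R \<longrightarrow>
            (\<forall>g \<in> carrier G. \<not> p dvd group.ord G g))"
  shows "integer_localization R (order_primes_monoid G)"
proof -
  interpret ring R by fact
  have "r = \<zero>\<^bsub>R\<^esub>" if "n \<in> order_primes_monoid G" "r \<in> carrier R" "[n] \<cdot>\<^bsub>R\<^esub> r = \<zero>\<^bsub>R\<^esub>" for n r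
    using that
  proof (induction n rule: less_induct)
    case (less n)
    have n: "n > 0" using less.prems by (simp add: order_primes_monoid_def)
    show ?case
    proof (cases "n = 1")
      case True
      then show ?thesis using less.prems by simp
    next
      case False
      then obtain p where p: "Factorial_Ring.prime p" "p dvd n" using prime_factor_nat by blast
      then obtain k where k: "n = p * k" by auto
      have "k \<in> order_primes_monoid G"
        using less.prems(1) k by (auto simp: order_primes_monoid_def)
      moreover have "k < n" using k n prime_gt_1_nat[OF p(1)] by simp
      moreover have "[k] \<cdot>\<^bsub>R\<^esub> r = \<zero>\<^bsub>R\<^esub>"
      proof (rule ccontr)
        assume ne: "[k] \<cdot>\<^bsub>R\<^esub> r \<noteq> \<zero>\<^bsub>R\<^esub>"
        have p0: "[p] \<cdot>\<^bsub>R\<^esub> ([k] \<cdot>\<^bsub>R\<^esub> r) = \<zero>\<^bsub>R\<^esub>"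
          using less.prems k by (simp add: add.nat_pow_pow mult.commute)
        with ne less.prems(2) have "has_p_torsion p R"
          unfolding has_p_torsion_def by blast
        moreover have "\<not> torsion_free_ring R"
          using ne p0 less.prems(2) prime_gt_0_nat[OF p(1)] unfolding torsion_free_ring_def by blast
        moreover obtain g where "g \<in> carrier G" "p dvd group.ord G g"
          using less.prems(1) p unfolding order_primes_monoid_def by blast
        ultimately show False using assms(3) p(1) by blast
      qed
      ultimately show ?thesis using less.IH less.prems(2) by blast
    qed
  qed
  then show ?thesis
    by unfold_locales (auto simp: order_primes_monoid_def prime_dvd_mult_iff)
qed

theorem theorem1p1:
  fixes G :: "('g, 'n) monoid_scheme"
    and R :: "('r, 'm) ring_scheme"
    and \<sigma> \<tau> :: "('g \<Rightarrow> 'r) \<Rightarrow> ('g \<Rightarrow> 'r)"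
  assumes "torsion_group G"
    and "finite (rcosets\<^bsub>G\<^esub> (center G))"
    and "semiprime_ring R"
    and "torsion_free_ring R \<or>
         (\<forall>p::nat. Factorial_Ring.prime p \<longrightarrow> has_p_torsion p R \<longrightarrow>
            (\<forall>g \<in> carrier G. \<not> p dvd group.ord G g))"
    and "linear_ring_endo R G \<sigma>"
    and "linear_ring_endo R G \<tau>"
    and "\<forall>c \<in> center (group_ring R G). \<sigma> c = c"
    and "\<forall>c \<in> center (group_ring R G). \<tau> c = c"
  shows "\<exists>(T :: ('r \<times> nat) set ring) (\<iota> :: 'r \<Rightarrow> ('r \<times> nat) set).
           ring T \<and> ring_embedding R T \<iota> \<and> \<iota> ` center R \<subseteq> center T \<and>
           linear_ring_endo T G (extend_linear R T \<iota> G \<sigma>) \<and>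
           linear_ring_endo T G (extend_linear R T \<iota> G \<tau>) \<and>
           H1_vanishes T G (extend_linear R T \<iota> G \<sigma>) (extend_linear R T \<iota> G \<tau>)"
proof -
  have R: "ring R" using assms(3) by (simp add: semiprime_ring_def)
  have G: "group G" and torsion: "\<And>g. g \<in> carrier G \<Longrightarrow> \<exists>n::nat. n > 0 \<and> g [^]\<^bsub>G\<^esub> n = \<one>\<^bsub>G\<^esub>"
    using assms(1) by (auto simp: torsion_group_def)
  let ?M = "order_primes_monoid G"
  interpret G: group G by (rule G)
  interpret A: group_algebra R G by (rule group_algebra.intro[OF R G])
  interpret L: integer_localization R ?M by (rule order_primes_localization[OF R G assms(4)])
  define T where "T = L.localization"
  define \<iota> where "\<iota> = (\<lambda>r. L.fraction r 1)"
  have T: "ring T" unfolding T_def by (rule L.ring_localization)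
  interpret T: ring T by (rule T)
  interpret B: group_algebra T G by (rule group_algebra.intro[OF T G])
  have emb: "ring_embedding R T \<iota>" unfolding T_def \<iota>_def by (rule L.localization_embedding)
  have cent: "\<iota> ` center R \<subseteq> center T" unfolding T_def \<iota>_def by (rule L.localization_center)
  have \<iota>: "\<iota> \<in> ring_hom R T" using emb by (simp add: ring_embedding_def)
  note endo = extend_linear_endo[OF A.group_algebra_axioms T \<iota> cent]
  \<comment> \<open>On \<open>z\<close> the extension takes the value \<iota> \<circ> \<phi>(z) =
    \<iota> \<circ> z, and \<iota> preserves the coefficients 0 and 1.\<close>
  have fix_center: "extend_linear R T \<iota> G \<phi> (group_elem T z) = group_elem T z"
    if "linear_ring_endo R G \<phi>" "\<forall>c \<in> center (group_ring R G). \<phi> c = c" "z \<in> center G" for \<phi> z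
  proof -
    have "\<phi> (group_elem R z) = group_elem R z"
      using that(2) A.group_elem_in_center[OF that(3)] by blast
    then have "extend_linear R T \<iota> G \<phi> (group_elem T z) = \<iota> \<circ> group_elem R z"
      using endo(2)[OF that(1) center_closed[OF that(3)]] by simp
    also have "\<dots> = group_elem T z"
      using ring_hom_one[OF \<iota>] ring_hom_zero[OF \<iota> R T] by (simp add: group_elem_def fun_eq_iff)
    finally show ?thesis .
  qed
  \<comment> \<open>Torsion excludes the value 0 that \<open>ord\<close> takes on elements of
    infinite order.\<close>
  have ord_mem: "G.ord g \<in> ?M" if "g \<in> carrier G" for g
  proof -
    have "G.ord g > 0" using torsion[OF that] G.pow_eq_id[OF that] dvd_pos_nat by blast
    with that show ?thesis unfolding order_primes_monoid_def by blast
  qed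
  let ?m = "card (rcosets\<^bsub>G\<^esub> (center G))"
  have m_mem: "?m \<in> ?M"
  proof -
    have "center G #>\<^bsub>G\<^esub> \<one>\<^bsub>G\<^esub> \<in> rcosets\<^bsub>G\<^esub> (center G)"
      using G.one_closed unfolding RCOSETS_def by blast
    then have "card (rcosets\<^bsub>G\<^esub> (center G)) > 0" using assms(2) card_gt_0_iff by blast
    then show ?thesis
      using G.prime_dvd_index[OF G.center_normal assms(2)] unfolding order_primes_monoid_def by blast
  qed
  have divisible: "\<exists>!y. y \<in> carrier T \<and> [n] \<cdot>\<^bsub>T\<^esub> y = x" if "n \<in> ?M" "x \<in> carrier T" for n x
    using L.localization_divisible that unfolding T_def by blast
  \<comment> \<open>Uniqueness of the quotient, read as cancellation of \<open>n\<close> in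
    \<open>T\<close>.\<close>
  have cancel: "x = y" if "n \<in> ?M" "x \<in> carrier T" "y \<in> carrier T" "[n] \<cdot>\<^bsub>T\<^esub> x = [n] \<cdot>\<^bsub>T\<^esub> y" for n x y
    using divisible[OF that(1) T.add.nat_pow_closed[OF that(3), of n]] that by blast
  obtain u where u: "u \<in> carrier T" "[?m] \<cdot>\<^bsub>T\<^esub> u = \<one>\<^bsub>T\<^esub>"
    using divisible[OF m_mem T.one_closed] by blast
  \<comment> \<open>The \<open>?m\<close>-fold multiples of \<open>u x\<close> and
    \<open>x u\<close> both equal \<open>x\<close>, and \<open>?m\<close> can be cancelled.\<close>
  have u_center: "u \<in> center T"
  proof (rule centerI[OF u(1)])
    fix x assume x: "x \<in> carrier T"
    show "u \<otimes>\<^bsub>T\<^esub> x = x \<otimes>\<^bsub>T\<^esub> u"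
    proof (rule cancel[OF m_mem])
      show "[?m] \<cdot>\<^bsub>T\<^esub> (u \<otimes>\<^bsub>T\<^esub> x) = [?m] \<cdot>\<^bsub>T\<^esub> (x \<otimes>\<^bsub>T\<^esub> u)"
        unfolding T.add_pow_ldistr[OF u(1) x, symmetric] T.add_pow_rdistr[OF x u(1), symmetric] u(2)
        using x by simp
    qed (use u x in simp_all)
  qed
  have "skew_inner T G (extend_linear R T \<iota> G \<sigma>) (extend_linear R T \<iota> G \<tau>) \<delta>"
    if "skew_derivation T G (extend_linear R T \<iota> G \<sigma>) (extend_linear R T \<iota> G \<tau>) \<delta>" for \<delta>
  proof -
    interpret D: group_ring_derivation T G "extend_linear R T \<iota> G \<sigma>" "extend_linear R T \<iota> G \<tau>" \<delta>
      by unfold_locales (use that assms endo(1) fix_center in auto)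
    show ?thesis
    proof (rule D.skew_inner_if_index_invertible[OF assms(2) _ u_center u(2)])
      fix z assume z: "z \<in> center G"
      note zG = center_closed[OF z]
      show "\<delta> (group_elem T z) = \<zero>\<^bsub>group_ring T G\<^esub>"
      \<comment> \<open>The exponent is the order of \<open>z\<close>, which lies in the set of
        denominators and therefore cancels in \<open>T\<close>.\<close>
      proof (rule D.\<delta>_central[OF z])
        show "G.ord z > 0" using ord_mem[OF zG] by (simp add: order_primes_monoid_def)
        show "z [^]\<^bsub>G\<^esub> G.ord z = \<one>\<^bsub>G\<^esub>" using zG by simp
        fix r assume "r \<in> carrier T" "[(G.ord z)] \<cdot>\<^bsub>T\<^esub> r = \<zero>\<^bsub>T\<^esub>"
        then show "r = \<zero>\<^bsub>T\<^esub>"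
          using cancel[OF ord_mem[OF zG], of r "\<zero>\<^bsub>T\<^esub>"] by simp
      qed
    qed
  qed
  then show ?thesis
    using T emb cent endo(1)[OF assms(5)] endo(1)[OF assms(6)] unfolding H1_vanishes_def by blast
qed

end
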